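(* Let $\Phi:M_n(\mathbb{C})\to M_n(\mathbb{C})$ be a quantum channel with Kraus operators $K=(K_1,\dots,K_d)$. The following statements are equivalent: (1) $\Phi$ is positively factorizable via an abelian von Neumann algebra. (2) There is a set of Kraus operators $\{L_i\}$ for $\Phi$ such that every $L_i$ is entrywise nonnegative. (3) The Choi matrix $J(\Phi)$ is a completely positive (CP) matrix.
   Context: A quantum channel is a trace-preserving completely positive linear map $\Phi:M_n(\mathbb{C})\to M_n(\mathbb{C})$; matrices $K_1,\dots,K_d\in M_n(\mathbb{C})$ are Kraus operators for $\Phi$ if $\Phi(X)=\sum_{i=1}^d K_iXK_i^*$ for all $X$. The Choi matrix is $J(\Phi)=\sum_{i,j=1}^n E_{ij}\otimes\Phi(E_{ij})$, where $E_{ij}$ are the matrix units. A channel $\Phi$ is positively factorizable via $(\mathcal{A},\tau)$, where $\mathcal{A}$ is a finite von Neumann algebra with a faithful normal (finite) trace $\tau$, if there is $Z=(Z(i,j))\in M_n(\mathbb{C})\otimes\mathcal{A}=M_n(\mathcal{A})$, each entry $Z(i,j)$ being a positive element of $\mathcal{A}$, such that $\Phi(X)=(\mathrm{id}\otimes\tau)(Z(X\otimes 1_{\mathcal{A}})Z^* )$ for all $X\in M_n(\mathbb{C})$. It is positively factorizable via an abelian algebra if this holds for some abelian $\mathcal{A}$ and some such $\tau$. A symmetric $N\times N$ matrix $X$ is completely positive (CP) if there are entrywise nonnegative vectors $p_1,\dots,p_N\in\mathbb{R}_+^k$, for some $k\ge1$, with $X_{ij}=\langle p_i,p_j\rangle$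 for all $i,j$. *)

theory Defs
  imports "HOL-Analysis.Analysis"
begin

section \<open>Complex Hilbert spaces\<close>

text \<open>
  The inner product is linear in the first argument. The last axiom says at once that the inner
  product is positive definite and that it induces the norm; \<^class>\<open>banach\<close> supplies completeness.
\<close>

class complex_hilbert_space = banach +
  fixes scaleC :: "complex \<Rightarrow> 'a \<Rightarrow> 'a"  (infixr \<open>*\<^sub>C\<close> 75)
    and cinner :: "'a \<Rightarrow> 'a \<Rightarrow> complex"
  assumes scaleC_add_right: "c *\<^sub>C (x + y) = c *\<^sub>C x + c *\<^sub>C y"
    and scaleC_add_left: "(c + d) *\<^sub>C x = c *\<^sub>C x + d *\<^sub>C x"
    and scaleC_scaleC: "c *\<^sub>C d *\<^sub>C x = (c * d) *\<^sub>C x"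
    and scaleR_scaleC: "r *\<^sub>R x = complex_of_real r *\<^sub>C x"
    and cinner_commute: "cinner x y = cnj (cinner y x)"
    and cinner_add_left: "cinner (x + y) z = cinner x z + cinner y z"
    and cinner_scaleC_left: "cinner (c *\<^sub>C x) y = c * cinner x y"
    and cinner_self: "cinner x x = complex_of_real ((norm x)\<^sup>2)"

definition bounded_clinear :: "('h::complex_hilbert_space \<Rightarrow> 'h) \<Rightarrow> bool" where
  "bounded_clinear T \<longleftrightarrow> bounded_linear T \<and> (\<forall>c x. T (c *\<^sub>C x) = c *\<^sub>C T x)"

text \<open>Unique whenever it exists, and existing for every bounded operator by the Riesz theorem.\<close>

definition hadj :: "('h::complex_hilbert_space \<Rightarrow> 'h) \<Rightarrow> 'h \<Rightarrow> 'h" where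
  "hadj T = (THE S. \<forall>x y. cinner (T x) y = cinner x (S y))"

definition positive_op :: "('h::complex_hilbert_space \<Rightarrow> 'h) \<Rightarrow> bool" where
  "positive_op T \<longleftrightarrow> bounded_clinear T \<and> (\<forall>x. cinner (T x) x \<in> \<real>\<^sub>\<ge>\<^sub>0)"

definition op_le :: "('h::complex_hilbert_space \<Rightarrow> 'h) \<Rightarrow> ('h \<Rightarrow> 'h) \<Rightarrow> bool" where
  "op_le S T \<longleftrightarrow> positive_op (\<lambda>x. T x - S x)"


section \<open>Von Neumann algebras with a finite trace\<close>

definition commutant :: "('h::complex_hilbert_space \<Rightarrow> 'h) set \<Rightarrow> ('h \<Rightarrow> 'h) set" where
  "commutant A = {T. bounded_clinear T \<and> (\<forall>S\<in>A. T \<circ> S = S \<circ> T)}"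

text \<open>
  Being its own double commutant makes \<open>A\<close> a unital, weakly closed subalgebra of the
  bounded operators.
\<close>

definition von_neumann_algebra :: "('h::complex_hilbert_space \<Rightarrow> 'h) set \<Rightarrow> bool" where
  "von_neumann_algebra A \<longleftrightarrow>
     (\<forall>T\<in>A. bounded_clinear T \<and> hadj T \<in> A) \<and> commutant (commutant A) = A"

definition finite_von_neumann_algebra :: "('h::complex_hilbert_space \<Rightarrow> 'h) set \<Rightarrow> bool" where
  "finite_von_neumann_algebra A \<longleftrightarrow>
     von_neumann_algebra A \<and> (\<forall>V\<in>A. hadj V \<circ> V = id \<longrightarrow> V \<circ> hadj V = id)"

definition abelian_algebra :: "('h \<Rightarrow> 'h) set \<Rightarrow> bool" where
  "abelian_algebra A \<longleftrightarrow> (\<forall>S\<in>A. \<forall>T\<in>A. S \<circ> T = T \<circ> S)"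

text \<open>A positive trace, finite in that it is defined on all of \<open>A\<close>; it need not be normalized.\<close>

definition finite_trace :: "('h::complex_hilbert_space \<Rightarrow> 'h) set \<Rightarrow> (('h \<Rightarrow> 'h) \<Rightarrow> complex) \<Rightarrow> bool" where
  "finite_trace A \<tau> \<longleftrightarrow>
     (\<forall>S\<in>A. \<forall>T\<in>A. \<tau> (\<lambda>x. S x + T x) = \<tau> S + \<tau> T) \<and>
     (\<forall>c. \<forall>T\<in>A. \<tau> (\<lambda>x. c *\<^sub>C T x) = c * \<tau> T) \<and>
     (\<forall>T\<in>A. positive_op T \<longrightarrow> \<tau> T \<in> \<real>\<^sub>\<ge>\<^sub>0) \<and>
     (\<forall>S\<in>A. \<forall>T\<in>A. \<tau> (S \<circ> T) = \<tau> (T \<circ> S))"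

definition faithful_on :: "('h::complex_hilbert_space \<Rightarrow> 'h) set \<Rightarrow> (('h \<Rightarrow> 'h) \<Rightarrow> complex) \<Rightarrow> bool" where
  "faithful_on A \<tau> \<longleftrightarrow> (\<forall>T\<in>A. positive_op T \<and> \<tau> T = 0 \<longrightarrow> T = (\<lambda>x. 0))"

text \<open>
  Normality: \<open>\<tau>\<close> preserves suprema of upward directed families of positive elements. Such a
  family has a supremum \<open>S\<close> in \<open>A\<close> as soon as it is bounded.
\<close>

definition normal_on :: "('h::complex_hilbert_space \<Rightarrow> 'h) set \<Rightarrow> (('h \<Rightarrow> 'h) \<Rightarrow> complex) \<Rightarrow> bool" where
  "normal_on A \<tau> \<longleftrightarrow>
     (\<forall>D S. D \<noteq> {} \<and> D \<subseteq> {T\<in>A. positive_op T} \<and>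
        (\<forall>T\<in>D. \<forall>U\<in>D. \<exists>V\<in>D. op_le T V \<and> op_le U V) \<and>
        S \<in> A \<and> (\<forall>T\<in>D. op_le T S) \<and> (\<forall>U\<in>A. (\<forall>T\<in>D. op_le T U) \<longrightarrow> op_le S U)
        \<longrightarrow> Re (\<tau> S) = (SUP T\<in>D. Re (\<tau> T)))"


section \<open>Matrices and quantum channels\<close>

definition ctranspose :: "complex^'n^'m \<Rightarrow> complex^'m^'n" where
  "ctranspose A = (\<chi> i j. cnj (A $ j $ i))"

definition matrix_unit :: "'n \<Rightarrow> 'n \<Rightarrow> complex^'n^'n" where
  "matrix_unit k l = (\<chi> i j. if i = k \<and> j = l then 1 else 0)"

definition kronecker :: "complex^'m^'m \<Rightarrow> complex^'n^'n \<Rightarrow> complex^('m \<times> 'n)^('m \<times> 'n)" where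
  "kronecker A B = (\<chi> p q. A $ fst p $ fst q * B $ snd p $ snd q)"

definition choi_matrix :: "(complex^'n^'n \<Rightarrow> complex^'n^'n) \<Rightarrow> complex^('n \<times> 'n)^('n::finite \<times> 'n)" where
  "choi_matrix \<Phi> = (\<Sum>i\<in>UNIV. \<Sum>j\<in>UNIV. kronecker (matrix_unit i j) (\<Phi> (matrix_unit i j)))"

definition clinear_map :: "(complex^'n^'n \<Rightarrow> complex^'n^'n) \<Rightarrow> bool" where
  "clinear_map \<Phi> \<longleftrightarrow>
     (\<forall>X Y. \<Phi> (X + Y) = \<Phi> X + \<Phi> Y) \<and>
     (\<forall>c X. \<Phi> (\<chi> i j. c * X $ i $ j) = (\<chi> i j. c * \<Phi> X $ i $ j))"

text \<open>
  A \<open>k \<times> k\<close> block matrix with blocks \<open>X a b\<close>, \<open>a, b < k\<close>, stands for an element of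
  \<open>M\<^sub>k \<otimes> M\<^sub>n\<close>; complete positivity says that applying \<open>\<Phi>\<close> blockwise preserves positive
  semidefiniteness for every \<open>k\<close>.
\<close>

definition block_psd :: "nat \<Rightarrow> (nat \<Rightarrow> nat \<Rightarrow> complex^'n^'n) \<Rightarrow> bool" where
  "block_psd k X \<longleftrightarrow>
     (\<forall>v :: nat \<Rightarrow> complex^'n.
        (\<Sum>a<k. \<Sum>b<k. \<Sum>i\<in>UNIV. \<Sum>j\<in>UNIV. cnj (v a $ i) * X a b $ i $ j * v b $ j) \<in> \<real>\<^sub>\<ge>\<^sub>0)"

definition completely_positive_map :: "(complex^'n^'n \<Rightarrow> complex^'n^'n) \<Rightarrow> bool" where
  "completely_positive_map \<Phi> \<longleftrightarrow>
     clinear_map \<Phi> \<and> (\<forall>k X. block_psd k X \<longrightarrow> block_psd k (\<lambda>a b. \<Phi> (X a b)))"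

definition quantum_channel :: "(complex^'n^'n \<Rightarrow> complex^'n^'n) \<Rightarrow> bool" where
  "quantum_channel \<Phi> \<longleftrightarrow> completely_positive_map \<Phi> \<and> (\<forall>X. trace (\<Phi> X) = trace X)"

definition kraus_operators :: "(complex^'n^'n) list \<Rightarrow> (complex^'n^'n \<Rightarrow> complex^'n^'n) \<Rightarrow> bool" where
  "kraus_operators Ks \<Phi> \<longleftrightarrow> (\<forall>X. \<Phi> X = (\<Sum>K\<leftarrow>Ks. K ** X ** ctranspose K))"

definition entrywise_nonneg :: "complex^'n^'m \<Rightarrow> bool" where
  "entrywise_nonneg A \<longleftrightarrow> (\<forall>i j. A $ i $ j \<in> \<real>\<^sub>\<ge>\<^sub>0)"

text \<open>The vectors \<open>p i\<close> live in \<open>\<real>\<^sup>k\<close>: only their first \<open>k\<close> coordinates count.\<close>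

definition cp_matrix :: "complex^'m^'m \<Rightarrow> bool" where
  "cp_matrix X \<longleftrightarrow> transpose X = X \<and>
     (\<exists>k\<ge>1. \<exists>p :: 'm \<Rightarrow> nat \<Rightarrow> real. (\<forall>i. \<forall>a<k. p i a \<ge> 0) \<and>
        (\<forall>i j. X $ i $ j = complex_of_real (\<Sum>a<k. p i a * p j a)))"


section \<open>Positive factorizability\<close>

text \<open>Elements of \<open>M\<^sub>n(\<A>)\<close> are matrices of operators.\<close>

definition opmat_mult ::
    "('h::complex_hilbert_space \<Rightarrow> 'h)^'n^'n \<Rightarrow> ('h \<Rightarrow> 'h)^'n^'n \<Rightarrow> ('h \<Rightarrow> 'h)^'n^'n" where
  "opmat_mult U V = (\<chi> i j. (\<lambda>x. \<Sum>k\<in>UNIV. (U $ i $ k) ((V $ k $ j) x)))"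

definition opmat_adj :: "('h::complex_hilbert_space \<Rightarrow> 'h)^'n^'n \<Rightarrow> ('h \<Rightarrow> 'h)^'n^'n" where
  "opmat_adj U = (\<chi> i j. hadj (U $ j $ i))"

definition ampliation :: "complex^'n^'n \<Rightarrow> ('h::complex_hilbert_space \<Rightarrow> 'h)^'n^'n" where
  "ampliation X = (\<chi> i j. (\<lambda>x. (X $ i $ j) *\<^sub>C x))"  \<comment> \<open>\<open>X \<otimes> 1\<close>\<close>

definition id_tensor :: "(('h \<Rightarrow> 'h) \<Rightarrow> complex) \<Rightarrow> ('h \<Rightarrow> 'h)^'n^'n \<Rightarrow> complex^'n^'n" where
  "id_tensor \<tau> W = (\<chi> i j. \<tau> (W $ i $ j))"  \<comment> \<open>\<open>(id \<otimes> \<tau>) W\<close>\<close>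

definition positively_factorizable_via ::
    "('h::complex_hilbert_space \<Rightarrow> 'h) set \<Rightarrow> (('h \<Rightarrow> 'h) \<Rightarrow> complex) \<Rightarrow>
     (complex^'n^'n \<Rightarrow> complex^'n^'n) \<Rightarrow> bool" where
  "positively_factorizable_via A \<tau> \<Phi> \<longleftrightarrow>
     finite_von_neumann_algebra A \<and> finite_trace A \<tau> \<and> faithful_on A \<tau> \<and> normal_on A \<tau> \<and>
     (\<exists>Z :: ('h \<Rightarrow> 'h)^'n^'n. (\<forall>i j. Z $ i $ j \<in> A \<and> positive_op (Z $ i $ j)) \<and>
        (\<forall>X. \<Phi> X = id_tensor \<tau> (opmat_mult (opmat_mult Z (ampliation X)) (opmat_adj Z))))"

text \<open>
  The type argument is the Hilbert space on which the algebra acts. HOL formulas cannot quantify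
  over types, so ``for some abelian von Neumann algebra'' is rendered by two types: a free type
  variable for the Hilbert space where factorizability is assumed, and the concrete space
  \<open>nat ell2\<close> below where it is asserted.
\<close>

definition positively_factorizable_abelian ::
    "'h::complex_hilbert_space itself \<Rightarrow> (complex^'n^'n \<Rightarrow> complex^'n^'n) \<Rightarrow> bool" where
  "positively_factorizable_abelian _ \<Phi> \<longleftrightarrow>
     (\<exists>(A :: ('h \<Rightarrow> 'h) set) \<tau>. abelian_algebra A \<and> positively_factorizable_via A \<tau> \<Phi>)"


section \<open>The Hilbert space of square-summable families\<close>

typedef 'i ell2 = "{f :: 'i \<Rightarrow> complex. (\<lambda>i. (cmod (f i))\<^sup>2) summable_on UNIV}"
  morphisms ell2_coord Abs_ell2
  by (rule exI[of _ "\<lambda>_. 0"]) simp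

setup_lifting type_definition_ell2

lemma real_summable_on_comparison:
  fixes f g :: "'i \<Rightarrow> real"
  assumes "g summable_on A" "\<And>i. i \<in> A \<Longrightarrow> 0 \<le> f i" "\<And>i. i \<in> A \<Longrightarrow> f i \<le> g i"
  shows "f summable_on A"
  using summable_on_comparison_test[OF assms(1,3,2)] by simp

lemma cmod_add_sq_le: "(cmod (a + b))\<^sup>2 \<le> 2 * (cmod a)\<^sup>2 + 2 * (cmod b)\<^sup>2"
proof -
  have "(cmod (a + b))\<^sup>2 \<le> (cmod a + cmod b)\<^sup>2"
    by (intro power_mono norm_triangle_ineq) simp
  moreover have "0 \<le> (cmod a - cmod b)\<^sup>2" by simp
  ultimately show ?thesis by (simp add: power2_eq_square algebra_simps)
qed

lemma square_summable_add:
  assumes "(\<lambda>i. (cmod (f i))\<^sup>2) summable_on A" "(\<lambda>i. (cmod (g i))\<^sup>2) summable_on A"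
  shows "(\<lambda>i. (cmod (f i + g i))\<^sup>2) summable_on A"
  by (rule real_summable_on_comparison[where g = "\<lambda>i. 2 * (cmod (f i))\<^sup>2 + 2 * (cmod (g i))\<^sup>2"])
    (auto intro!: summable_on_add summable_on_cmult_right assms cmod_add_sq_le)

lemma square_summable_scale:
  assumes "(\<lambda>i. (cmod (f i))\<^sup>2) summable_on A"
  shows "(\<lambda>i. (cmod (c * f i))\<^sup>2) summable_on A"
  by (simp add: norm_mult power_mult_distrib summable_on_cmult_right assms)

lemma square_summable_mult:
  assumes "(\<lambda>i. (cmod (f i))\<^sup>2) summable_on A" "(\<lambda>i. (cmod (g i))\<^sup>2) summable_on A"
  shows "(\<lambda>i. f i * cnj (g i)) summable_on A"
proof -
  have "(\<lambda>i. norm (f i * cnj (g i))) summable_on A"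
  proof (rule real_summable_on_comparison[where g = "\<lambda>i. (cmod (f i))\<^sup>2 + (cmod (g i))\<^sup>2"])
    show "norm (f i * cnj (g i)) \<le> (cmod (f i))\<^sup>2 + (cmod (g i))\<^sup>2" for i
    proof -
      have "0 \<le> (cmod (f i) - cmod (g i))\<^sup>2" and "0 \<le> cmod (f i) * cmod (g i)" by simp_all
      then show ?thesis
        unfolding norm_mult complex_mod_cnj power2_diff by linarith
    qed
  qed (auto intro!: summable_on_add assms)
  then show ?thesis by (simp add: abs_summable_summable)
qed

instantiation ell2 :: (type) real_vector
begin
lift_definition zero_ell2 :: "'a ell2" is "\<lambda>_. 0" by simp
lift_definition plus_ell2 :: "'a ell2 \<Rightarrow> 'a ell2 \<Rightarrow> 'a ell2" is "\<lambda>f g i. f i + g i"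
  by (rule square_summable_add)
lift_definition uminus_ell2 :: "'a ell2 \<Rightarrow> 'a ell2" is "\<lambda>f i. - f i" by simp
lift_definition minus_ell2 :: "'a ell2 \<Rightarrow> 'a ell2 \<Rightarrow> 'a ell2" is "\<lambda>f g i. f i - g i"
  by (subst diff_conv_add_uminus) (rule square_summable_add, auto)
lift_definition scaleR_ell2 :: "real \<Rightarrow> 'a ell2 \<Rightarrow> 'a ell2" is "\<lambda>r f i. complex_of_real r * f i"
  by (rule square_summable_scale)
instance
  by standard (transfer; simp add: fun_eq_iff algebra_simps)+
end

lift_definition ell2_cinner :: "'i ell2 \<Rightarrow> 'i ell2 \<Rightarrow> complex" is
  "\<lambda>f g. infsum (\<lambda>i. f i * cnj (g i)) UNIV" .

lemma ell2_cinner_commute: "ell2_cinner x y = cnj (ell2_cinner y x)"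
  by transfer (simp flip: infsum_cnj add: mult.commute)

lemma ell2_cinner_add_left: "ell2_cinner (x + y) z = ell2_cinner x z + ell2_cinner y z"
  by transfer (simp add: distrib_right infsum_add square_summable_mult)

lemma ell2_cinner_self:
  "ell2_cinner x x = complex_of_real (infsum (\<lambda>i. (cmod (ell2_coord x i))\<^sup>2) UNIV)"
  by transfer (simp only: complex_norm_square[symmetric],
    rule infsumI, rule has_sum_of_real, rule has_sum_infsum, simp)

instantiation ell2 :: (type) real_inner
begin
definition "inner_ell2 (x :: 'a ell2) y = Re (ell2_cinner x y)"
definition "norm_ell2 (x :: 'a ell2) = sqrt (Re (ell2_cinner x x))"
definition "sgn_ell2 (x :: 'a ell2) = x /\<^sub>R norm x"
definition "dist_ell2 (x :: 'a ell2) y = norm (x - y)"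
definition [code del]:
  "(uniformity :: ('a ell2 \<times> 'a ell2) filter) = (INF e\<in>{0<..}. principal {(x, y). dist x y < e})"
definition [code del]:
  "open (U :: 'a ell2 set) \<longleftrightarrow> (\<forall>x\<in>U. eventually (\<lambda>(x', y). x' = x \<longrightarrow> y \<in> U) uniformity)"
instance
proof
  fix x y z :: "'a ell2" and r :: real
  show "inner x y = inner y x"
    unfolding inner_ell2_def by (subst ell2_cinner_commute) simp
  show "inner (x + y) z = inner x z + inner y z"
    by (simp add: inner_ell2_def ell2_cinner_add_left)
  show "inner (r *\<^sub>R x) y = r * inner x y"
    unfolding inner_ell2_def by transfer (simp add: mult.assoc infsum_cmult_right')
  show "0 \<le> inner x x"
    by (simp add: inner_ell2_def ell2_cinner_self infsum_nonneg)
  show "inner x x = 0 \<longleftrightarrow> x = 0"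
  proof
    assume "inner x x = 0"
    then have "infsum (\<lambda>i. (cmod (ell2_coord x i))\<^sup>2) UNIV \<le> 0"
      by (simp add: inner_ell2_def ell2_cinner_self)
    then have "(cmod (ell2_coord x i))\<^sup>2 = 0" for i
      by (rule nonneg_infsum_le_0D) (use ell2_coord[of x] in auto)
    then show "x = 0" by transfer auto
  next
    show "x = 0 \<Longrightarrow> inner x x = 0"
      by (simp add: inner_ell2_def ell2_cinner_self zero_ell2.rep_eq)
  qed
qed (simp_all add: sgn_ell2_def dist_ell2_def uniformity_ell2_def open_ell2_def
    norm_ell2_def inner_ell2_def)
end

lemma ell2_norm_sq: "(norm x)\<^sup>2 = infsum (\<lambda>i. (cmod (ell2_coord x i))\<^sup>2) UNIV"
  by (simp add: norm_ell2_def ell2_cinner_self infsum_nonneg)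

lemma ell2_sum_le_norm_sq: "finite F \<Longrightarrow> (\<Sum>i\<in>F. (cmod (ell2_coord x i))\<^sup>2) \<le> (norm x)\<^sup>2"
  unfolding ell2_norm_sq by (rule finite_sum_le_infsum) (use ell2_coord[of x] in auto)

lemma ell2_coord_le_norm: "cmod (ell2_coord x i) \<le> norm x"
  using ell2_sum_le_norm_sq[of "{i}" x] by (simp add: power2_le_iff_abs_le)

instance ell2 :: (type) banach
proof
  fix X :: "nat \<Rightarrow> 'a ell2"
  assume "Cauchy X"
  let ?f = "\<lambda>n i. ell2_coord (X n) i"
  have "Cauchy (\<lambda>n. ?f n i)" for i
  proof (rule metric_CauchyI)
    fix e :: real assume "0 < e"
    then obtain N where N: "\<And>m n. m \<ge> N \<Longrightarrow> n \<ge> N \<Longrightarrow> dist (X m) (X n) < e"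
      using metric_CauchyD[OF \<open>Cauchy X\<close>] by meson
    have "dist (?f m i) (?f n i) < e" if "m \<ge> N" "n \<ge> N" for m n
      using ell2_coord_le_norm[of "X m - X n" i] N[OF that]
      by (simp add: dist_norm minus_ell2.rep_eq)
    then show "\<exists>M. \<forall>m\<ge>M. \<forall>n\<ge>M. dist (?f m i) (?f n i) < e" by blast
  qed
  then have "\<forall>i. \<exists>l. (\<lambda>n. ?f n i) \<longlonglongrightarrow> l"
    by (simp add: Cauchy_convergent_iff convergent_def)
  then obtain g where g: "\<And>i. (\<lambda>n. ?f n i) \<longlonglongrightarrow> g i" by metis
  have bound: "(\<Sum>i\<in>F. (cmod (?f n i - g i))\<^sup>2) \<le> e\<^sup>2"
    if F: "finite F" and N: "\<And>m. m \<ge> N \<Longrightarrow> dist (X n) (X m) < e" for F n N e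
  proof (rule tendsto_upperbound)
    show "(\<lambda>m. \<Sum>i\<in>F. (cmod (?f n i - ?f m i))\<^sup>2) \<longlonglongrightarrow> (\<Sum>i\<in>F. (cmod (?f n i - g i))\<^sup>2)"
      by (intro tendsto_intros g)
    have "(\<Sum>i\<in>F. (cmod (?f n i - ?f m i))\<^sup>2) \<le> e\<^sup>2" if "m \<ge> N" for m
    proof -
      have "(\<Sum>i\<in>F. (cmod (?f n i - ?f m i))\<^sup>2) \<le> (norm (X n - X m))\<^sup>2"
        using ell2_sum_le_norm_sq[OF F, of "X n - X m"] by (simp add: minus_ell2.rep_eq)
      also have "\<dots> \<le> e\<^sup>2"
        using N[OF that] by (intro power_mono) (auto simp: dist_norm)
      finally show ?thesis .
    qed
    then show "\<forall>\<^sub>F m in sequentially. (\<Sum>i\<in>F. (cmod (?f n i - ?f m i))\<^sup>2) \<le> e\<^sup>2"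
      by (auto simp: eventually_sequentially)
  qed simp
  have summ: "(\<lambda>i. (cmod (?f n i - g i))\<^sup>2) summable_on UNIV"
    if "\<And>m. m \<ge> N \<Longrightarrow> dist (X n) (X m) < e" for n N e
    by (rule nonneg_bdd_above_summable_on) (use bound[OF _ that] in \<open>auto simp: bdd_above_def\<close>)
  obtain N1 where N1: "\<And>m. m \<ge> N1 \<Longrightarrow> dist (X N1) (X m) < 1"
    using metric_CauchyD[OF \<open>Cauchy X\<close>, of 1] by auto
  have "(\<lambda>i. (cmod (?f N1 i + (-1) * (?f N1 i - g i)))\<^sup>2) summable_on UNIV"
    using ell2_coord[of "X N1"] summ[OF N1]
    by (intro square_summable_add square_summable_scale) auto
  then have "(\<lambda>i. (cmod (g i))\<^sup>2) summable_on UNIV" by simp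
  then have coord: "ell2_coord (Abs_ell2 g) = g" by (simp add: Abs_ell2_inverse)
  have "X \<longlonglongrightarrow> Abs_ell2 g"
  proof (rule metric_LIMSEQ_I)
    fix e :: real assume "0 < e"
    then obtain N where N: "\<And>m n. m \<ge> N \<Longrightarrow> n \<ge> N \<Longrightarrow> dist (X m) (X n) < e / 2"
      using metric_CauchyD[OF \<open>Cauchy X\<close>, of "e / 2"] by (meson half_gt_zero)
    have "dist (X n) (Abs_ell2 g) < e" if "n \<ge> N" for n
    proof -
      have "(norm (X n - Abs_ell2 g))\<^sup>2 \<le> (e / 2)\<^sup>2"
        unfolding ell2_norm_sq minus_ell2.rep_eq coord
        by (intro infsum_le_finite_sums summ[OF N[OF that]] bound[OF _ N[OF that]])
      then have "norm (X n - Abs_ell2 g) \<le> e / 2"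
        using \<open>0 < e\<close> by (simp add: power2_le_iff_abs_le)
      then show ?thesis using \<open>0 < e\<close> by (simp add: dist_norm)
    qed
    then show "\<exists>N. \<forall>n\<ge>N. dist (X n) (Abs_ell2 g) < e" by blast
  qed
  then show "convergent X" by (auto simp: convergent_def)
qed

instantiation ell2 :: (type) complex_hilbert_space
begin
lift_definition scaleC_ell2 :: "complex \<Rightarrow> 'a ell2 \<Rightarrow> 'a ell2" is "\<lambda>c f i. c * f i"
  by (rule square_summable_scale)
definition "cinner_ell2 = (ell2_cinner :: 'a ell2 \<Rightarrow> 'a ell2 \<Rightarrow> complex)"
instance
proof
  fix x y z :: "'a ell2" and c d :: complex and r :: real
  show "c *\<^sub>C (x + y) = c *\<^sub>C x + c *\<^sub>C y" by transfer (simp add: distrib_left)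
  show "(c + d) *\<^sub>C x = c *\<^sub>C x + d *\<^sub>C x" by transfer (simp add: distrib_right)
  show "c *\<^sub>C d *\<^sub>C x = (c * d) *\<^sub>C x" by transfer (simp add: mult.assoc)
  show "r *\<^sub>R x = complex_of_real r *\<^sub>C x" by transfer simp
  show "cinner x y = cnj (cinner y x)" 
    unfolding cinner_ell2_def by (rule ell2_cinner_commute)
  show "cinner (x + y) z = cinner x z + cinner y z"
    by (simp add: cinner_ell2_def ell2_cinner_add_left)
  show "cinner (c *\<^sub>C x) y = c * cinner x y"
    unfolding cinner_ell2_def by transfer (simp add: mult.assoc infsum_cmult_right')
  show "cinner x x = complex_of_real ((norm x)\<^sup>2)"
    unfolding ell2_norm_sq by (simp add: cinner_ell2_def ell2_cinner_self)
qed
end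

end

theory Submission
  imports Defs "HOL-Library.Multiset"
begin

text \<open>
  Entrywise, the Choi matrix of \<open>X \<mapsto> \<Sum>L X L\<^sup>*\<close> is \<open>\<Sum>vec L (vec L)\<^sup>*\<close>, so nonnegative Kraus operators
  are the same thing as nonnegative vectors of a CP factorization. They give a factorization through the
  diagonal operators on \<open>\<ell>\<^sub>2\<close>, with the \<open>a\<close>-th Kraus operator in the \<open>a\<close>-th diagonal entry, rescaled by
  the weight of the trace. Conversely, factorizability through an abelian algebra makes the Choi
  matrix a Gram matrix \<open>\<tau>(z\<^sub>a z\<^sub>b)\<close> of commuting positive operators, which may be scaled to
  \<open>0 \<le> z\<^sub>a \<le> 1\<close>. Instead of representing the algebra as functions on a measure space, approximate as
  Bernstein did: expanding the powers of \<open>z\<^sub>a + (1 - z\<^sub>a)\<close> writes \<open>1\<close> as a sum of positive operators, hence the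
  second moments of independent success frequencies lie in the cone over the convex hull of
  \<open>p p\<^sup>T\<close> with \<open>p \<in> [0,1]\<^sup>m\<close>. For a fixed total mass this set is compact, and the moments converge to \<open>\<tau>(z\<^sub>a z\<^sub>b)\<close>.
\<close>

section \<open>Inner products, adjoints and positive operators\<close>

lemma cinner_add_right:
  fixes x y z :: "'h::complex_hilbert_space"
  shows "cinner x (y + z) = cinner x y + cinner x z"
  by (metis cinner_add_left cinner_commute complex_cnj_add)

lemma cinner_scaleC_right:
  fixes x y :: "'h::complex_hilbert_space"
  shows "cinner x (c *\<^sub>C y) = cnj c * cinner x y"
  by (metis cinner_scaleC_left cinner_commute complex_cnj_mult)

lemma cinner_diff_left:
  fixes x y z :: "'h::complex_hilbert_space"
  shows "cinner (x - y) z = cinner x z - cinner y z"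
  by (metis add_diff_cancel_right' cinner_add_left diff_add_cancel)

lemma cinner_diff_right:
  fixes x y z :: "'h::complex_hilbert_space"
  shows "cinner x (y - z) = cinner x y - cinner x z"
  by (metis add_diff_cancel_right' cinner_add_right diff_add_cancel)

lemma scaleC_one [simp]: "1 *\<^sub>C x = (x :: 'h::complex_hilbert_space)"
  using scaleR_scaleC[of 1 x] by simp

lemma scaleC_zero_left [simp]: "0 *\<^sub>C x = (0 :: 'h::complex_hilbert_space)"
  using scaleR_scaleC[of 0 x] by simp

lemma scaleC_diff_right: "c *\<^sub>C (x - y) = c *\<^sub>C x - c *\<^sub>C (y :: 'h::complex_hilbert_space)"
  by (metis add_diff_cancel_right' diff_add_cancel scaleC_add_right)

lemma cinner_eqI:
  fixes x y :: "'h::complex_hilbert_space"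
  assumes "\<And>z. cinner z x = cinner z y"
  shows "x = y"
proof -
  have "cinner (x - y) (x - y) = 0"
    using assms by (simp add: cinner_diff_right)
  then show ?thesis by (simp add: cinner_self)
qed

lemma norm_add_sq:
  fixes x y :: "'h::complex_hilbert_space"
  shows "(norm (x + y))\<^sup>2 = (norm x)\<^sup>2 + 2 * Re (cinner x y) + (norm y)\<^sup>2"
proof -
  have "cinner (x + y) (x + y) = cinner x x + (cinner x y + cnj (cinner x y)) + cinner y y"
    using cinner_commute[of y x] by (simp add: cinner_add_left cinner_add_right)
  then show ?thesis
    by (simp add: cinner_self complex_eq_iff del: of_real_power)
qed

lemma norm_diff_sq:
  fixes x y :: "'h::complex_hilbert_space"
  shows "(norm (x - y))\<^sup>2 = (norm x)\<^sup>2 - 2 * Re (cinner x y) + (norm y)\<^sup>2"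
  using norm_add_sq[of "x - y" y] cinner_self[of y]
  by (simp add: cinner_diff_left del: of_real_power)

text \<open>\<open>cinner_eqI\<close> makes an adjoint unique, so exhibiting a candidate settles the
  definite description in \<open>hadj\<close>.\<close>

lemma hadj_eqI:
  assumes "\<And>x y. cinner (T x) y = cinner x (S y)"
  shows "hadj T = S"
  unfolding hadj_def
proof (rule the_equality)
  show "\<forall>x y. cinner (T x) y = cinner x (S y)" using assms by simp
  fix S' assume "\<forall>x y. cinner (T x) y = cinner x (S' y)"
  then show "S' = S" using assms by (intro ext cinner_eqI) metis
qed

lemma positive_opD:
  assumes "positive_op T"
  shows "Re (cinner (T x) x) \<ge> 0" "Im (cinner (T x) x) = 0"
  using assms by (auto simp: positive_op_def complex_nonneg_Reals_iff)

lemma bounded_clinearD: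
  assumes "bounded_clinear T"
  shows "T (x + y) = T x + T y" "T (x - y) = T x - T y" "T 0 = 0" "T (c *\<^sub>C x) = c *\<^sub>C T x"
    "bounded_linear T"
  using assms unfolding bounded_clinear_def
  by (auto dest: bounded_linear.linear simp: linear_add linear_diff linear_0)

text \<open>Polarization: over the complex numbers a real quadratic form comes from a symmetric operator.\<close>

lemma positive_op_symmetric:
  assumes "positive_op T"
  shows "cinner (T x) y = cinner x (T y)"
proof -
  have bc: "bounded_clinear T" using assms by (simp add: positive_op_def)
  note T = bounded_clinearD[OF bc]
  \<comment> \<open>Testing the form at x + y relates the imaginary parts of the cross terms; at x +
    i y, below, the factor i exposes their real parts.\<close>
  have 1: "Im (cinner (T x) y) + Im (cinner (T y) x) = 0"
    using positive_opD(2)[OF assms, of "x + y"] positive_opD(2)[OF assms, of x]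
      positive_opD(2)[OF assms, of y]
    by (simp add: T cinner_add_left cinner_add_right)
  have 2: "Re (cinner (T y) x) - Re (cinner (T x) y) = 0"
    using positive_opD(2)[OF assms, of "x + \<i> *\<^sub>C y"] positive_opD(2)[OF assms, of x]
      positive_opD(2)[OF assms, of y]
    by (simp add: T cinner_add_left cinner_add_right cinner_scaleC_left cinner_scaleC_right)
  have "cinner (T x) y = cnj (cinner (T y) x)"
    using 1 2 by (simp add: complex_eq_iff)
  then show ?thesis by (metis cinner_commute)
qed

lemma hadj_positive: "positive_op T \<Longrightarrow> hadj T = T"
  by (intro hadj_eqI positive_op_symmetric)

lemma bounded_clinear_compose:
  "bounded_clinear S \<Longrightarrow> bounded_clinear T \<Longrightarrow> bounded_clinear (\<lambda>x. S (T x))"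
  unfolding bounded_clinear_def by (simp add: bounded_linear_compose)

lemma bounded_clinear_diff:
  "bounded_clinear S \<Longrightarrow> bounded_clinear T \<Longrightarrow> bounded_clinear (\<lambda>x. S x - T x)"
  unfolding bounded_clinear_def by (simp add: bounded_linear_sub scaleC_diff_right)

lemma bounded_clinear_id: "bounded_clinear (\<lambda>x. x)"
  by (simp add: bounded_clinear_def bounded_linear_ident)

lemma norm_scaleC: "norm (c *\<^sub>C x) = cmod c * norm (x :: 'h::complex_hilbert_space)"
proof -
  have "cinner (c *\<^sub>C x) (c *\<^sub>C x) = (c * cnj c) * cinner x x"
    by (simp add: cinner_scaleC_left cinner_scaleC_right)
  also have "\<dots> = complex_of_real ((cmod c * norm x)\<^sup>2)"
    by (simp add: cinner_self complex_norm_square[symmetric] power_mult_distrib)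
  finally have "(norm (c *\<^sub>C x))\<^sup>2 = (cmod c * norm x)\<^sup>2"
    unfolding cinner_self by (simp only: of_real_eq_iff)
  then show ?thesis by (simp add: power2_eq_iff_nonneg)
qed

lemma bounded_clinear_scaleC:
  assumes "bounded_clinear T"
  shows "bounded_clinear (\<lambda>x. c *\<^sub>C T x)"
proof -
  have "bounded_linear ((*\<^sub>C) c :: 'a \<Rightarrow> 'a)"
    by (rule bounded_linear_intro[where K = "cmod c"])
      (simp_all add: scaleC_add_right scaleR_scaleC scaleC_scaleC norm_scaleC mult.commute)
  then show ?thesis
    using assms unfolding bounded_clinear_def
    by (auto simp: scaleC_scaleC mult.commute intro: bounded_linear_compose)
qed

section \<open>Products of commuting positive operators\<close>

text \<open>Riesz's iteration: the squares of the iterates telescope to \<open>T\<close>.\<close>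

primrec riesz_iterate :: "('h::complex_hilbert_space \<Rightarrow> 'h) \<Rightarrow> nat \<Rightarrow> 'h \<Rightarrow> 'h" where
  "riesz_iterate T 0 = T"
| "riesz_iterate T (Suc k) =
     (\<lambda>x. riesz_iterate T k x - riesz_iterate T k (riesz_iterate T k x))"

lemma positive_op_id: "positive_op (\<lambda>x. x)"
  by (simp add: positive_op_def bounded_clinear_id cinner_self)

text \<open>T - T^2 = T (1 - T) T + (1 - T) T (1 - T) and 1 - (T - T^2) = (1 - T) + T^2, and
  symmetry of T shows each summand to be positive. So passing from T to T - T^2 preserves 0 \<le> T
  \<le> 1, and the iteration can continue.\<close>

lemma positive_op_diff_square:
  assumes T: "positive_op T" and T': "positive_op (\<lambda>x. x - T x)"
  shows "positive_op (\<lambda>x. T x - T (T x))" "positive_op (\<lambda>x. x - (T x - T (T x)))"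
proof -
  have bc: "bounded_clinear T" using T by (simp add: positive_op_def)
  note TD = bounded_clinearD[OF bc]
  note sym = positive_op_symmetric[OF T, symmetric]
  have bc2: "bounded_clinear (\<lambda>x. T x - T (T x))"
    by (rule bounded_clinear_diff[OF bc bounded_clinear_compose[OF bc bc]])
  show "positive_op (\<lambda>x. T x - T (T x))"
    unfolding positive_op_def
  proof (intro conjI allI bc2)
    fix x
    have "cinner (T x - T (T x)) x =
        cinner (T x - T (T x)) (T x) + cinner (T (x - T x)) (x - T x)"
      by (simp add: TD sym cinner_diff_left cinner_diff_right)
    moreover have "cinner (T x - T (T x)) (T x) \<in> \<real>\<^sub>\<ge>\<^sub>0" "cinner (T (x - T x)) (x - T x) \<in> \<real>\<^sub>\<ge>\<^sub>0"
      using T T' by (auto simp: positive_op_def)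
    ultimately show "cinner (T x - T (T x)) x \<in> \<real>\<^sub>\<ge>\<^sub>0" by simp
  qed
  show "positive_op (\<lambda>x. x - (T x - T (T x)))"
    unfolding positive_op_def
  proof (intro conjI allI bounded_clinear_diff[OF bounded_clinear_id bc2])
    fix x
    have "cinner (x - (T x - T (T x))) x = cinner (x - T x) x + cinner (T x) (T x)"
      by (simp add: sym cinner_diff_left cinner_diff_right)
    moreover have "cinner (x - T x) x \<in> \<real>\<^sub>\<ge>\<^sub>0" "cinner (T x) (T x) \<in> \<real>\<^sub>\<ge>\<^sub>0"
      using T' by (auto simp: positive_op_def cinner_self)
    ultimately show "cinner (x - (T x - T (T x))) x \<in> \<real>\<^sub>\<ge>\<^sub>0" by simp
  qed
qed

lemma riesz_iterate_positive:
  assumes "positive_op T" "positive_op (\<lambda>x. x - T x)"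
  shows "positive_op (riesz_iterate T k) \<and> positive_op (\<lambda>x. x - riesz_iterate T k x)"
  by (induction k) (use assms positive_op_diff_square in auto)

lemma riesz_iterate_commute:
  assumes "\<And>x. S (T x) = T (S x)" "bounded_clinear S"
  shows "S (riesz_iterate T k x) = riesz_iterate T k (S x)"
  by (induction k arbitrary: x) (simp_all add: assms bounded_clinearD(2)[OF assms(2)])

text \<open>Writing R k for \<open>riesz_iterate T k\<close>, <R (k+1) x, x> = <R k x, x> - ||R k
  x||^2. Hence the squared norms have partial sums bounded by <T x, x> and tend to 0.\<close>

lemma riesz_iterate_tendsto_0:
  assumes "positive_op T" "positive_op (\<lambda>x. x - T x)"
  shows "(\<lambda>n. riesz_iterate T n x) \<longlonglongrightarrow> 0"
proof -
  let ?R = "riesz_iterate T"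
  have pos: "positive_op (?R k)" for k using riesz_iterate_positive[OF assms] by blast
  have step: "Re (cinner (?R (Suc k) x) x) = Re (cinner (?R k x) x) - (norm (?R k x))\<^sup>2" for k
    using positive_op_symmetric[OF pos[of k], of "?R k x" x]
    by (simp add: cinner_diff_left cinner_self)
  have sum_eq: "(\<Sum>k<n. (norm (?R k x))\<^sup>2) = Re (cinner (T x) x) - Re (cinner (?R n x) x)" for n
    by (induction n) (simp_all add: step del: riesz_iterate.simps(2))
  have "summable (\<lambda>k. (norm (?R k x))\<^sup>2)"
    by (rule summableI_nonneg_bounded[where x = "Re (cinner (T x) x)"])
      (auto simp: sum_eq positive_opD(1)[OF pos])
  then have "(\<lambda>k. (norm (?R k x))\<^sup>2) \<longlonglongrightarrow> 0" by (rule summable_LIMSEQ_zero)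
  from tendsto_real_sqrt[OF this] show ?thesis
    by (simp add: tendsto_norm_zero_iff)
qed

text \<open>T is the sum of the squares of R k for k < n, plus R n, and S commutes with every R k.
  So <S T x, x> is a sum of nonnegative terms <S (R k x), R k x> and a remainder <R n x, S x> that
  tends to 0.\<close>

lemma positive_op_compose_contraction:
  assumes S: "positive_op S" and T: "positive_op T" "positive_op (\<lambda>x. x - T x)"
    and comm: "\<And>x. S (T x) = T (S x)"
  shows "positive_op (\<lambda>x. S (T x))"
proof -
  let ?R = "riesz_iterate T"
  have bcS: "bounded_clinear S" and bcT: "bounded_clinear T"
    using S T by (simp_all add: positive_op_def)
  have posR: "positive_op (?R k)" for k using riesz_iterate_positive[OF T] by blast
  have "cinner (S (T x)) x \<in> \<real>\<^sub>\<ge>\<^sub>0" for x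
  proof -
    have eq: "cinner (S (T x)) x = cinner (?R n x) (S x)
        + (\<Sum>k<n. cinner (S (?R k x)) (?R k x))" for n
    proof (induction n)
      case 0
      show ?case using positive_op_symmetric[OF S, of "T x" x] by simp
    next
      case (Suc n)
      have "cinner (?R n (?R n x)) (S x) = cinner (?R n x) (?R n (S x))"
        by (rule positive_op_symmetric[OF posR])
      also have "?R n (S x) = S (?R n x)"
        by (rule riesz_iterate_commute[of S T n x, OF comm bcS, symmetric])
      also have "cinner (?R n x) (S (?R n x)) = cinner (S (?R n x)) (?R n x)"
        by (rule positive_op_symmetric[OF S, symmetric])
      finally have "cinner (?R n (?R n x)) (S x) = cinner (S (?R n x)) (?R n x)" .
      then show ?case using Suc by (simp add: cinner_diff_left)
    qed
    \<comment> \<open>Polarization expresses the real part of the remainder by norms, so that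
      continuity of the norm gives the limit.\<close>
    have "(\<lambda>n. ((norm (?R n x + S x))\<^sup>2 - (norm (?R n x - S x))\<^sup>2) / 4)
        \<longlonglongrightarrow> ((norm (0 + S x))\<^sup>2 - (norm (0 - S x))\<^sup>2) / 4"
      by (intro tendsto_intros riesz_iterate_tendsto_0 T) simp
    then have "(\<lambda>n. Re (cinner (?R n x) (S x))) \<longlonglongrightarrow> 0"
      by (simp add: norm_add_sq norm_diff_sq)
    moreover have "Re (cinner (?R n x) (S x)) \<le> Re (cinner (S (T x)) x)" for n
      using positive_opD(1)[OF S] unfolding eq[of n] by (simp add: sum_nonneg)
    ultimately have "0 \<le> Re (cinner (S (T x)) x)"
      by (intro LIMSEQ_le_const2) auto
    \<comment> \<open>Commutation makes the product symmetric, hence its quadratic form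
      real.\<close>
    moreover have "cinner (S (T x)) x = cnj (cinner (S (T x)) x)"
    proof -
      have "cinner (S (T x)) x = cinner x (S (T x))"
        by (simp add: positive_op_symmetric[OF S] positive_op_symmetric[OF T(1)] comm)
      then show ?thesis using cinner_commute by metis
    qed
    ultimately show ?thesis
      by (simp add: complex_nonneg_Reals_iff complex_eq_iff)
  qed
  then show ?thesis
    by (simp add: positive_op_def bounded_clinear_compose bcS bcT)
qed

section \<open>Bernstein approximation of moment matrices\<close>

definition outer :: "real^'m \<Rightarrow> real^'m^'m" where
  "outer p = (\<chi> i j. p $ i * p $ j)"

text \<open>Dividing by s + t turns the sum into a convex combination; if s + t = 0, both weights
  vanish and so do x and y. This adds up the pieces of a split while keeping track of the total
  mass.\<close>

lemma convex_scaled_add: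
  assumes "convex C" "0 \<le> s" "0 \<le> t" "x \<in> (*\<^sub>R) s ` C" "y \<in> (*\<^sub>R) t ` C"
  shows "x + y \<in> (*\<^sub>R) (s + t) ` C"
proof -
  obtain a b where ab: "a \<in> C" "x = s *\<^sub>R a" "b \<in> C" "y = t *\<^sub>R b" using assms by auto
  show ?thesis
  proof (cases "s + t = 0")
    case True
    then have "s = 0" "t = 0" using assms by auto
    then show ?thesis using ab by auto
  next
    case False
    then have "(s / (s + t)) *\<^sub>R a + (t / (s + t)) *\<^sub>R b \<in> C"
      using assms ab by (intro convexD) (auto simp: add_divide_distrib[symmetric])
    moreover have "x + y = (s + t) *\<^sub>R ((s / (s + t)) *\<^sub>R a + (t / (s + t)) *\<^sub>R b)"
      using False ab by (simp add: scaleR_add_right)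
    ultimately show ?thesis by blast
  qed
qed

text \<open>
  \<open>mul a\<close> and \<open>sub a\<close> stand for multiplication by \<open>z\<^sub>a\<close> and by \<open>1 - z\<^sub>a\<close>, where the \<open>z\<^sub>a\<close> are commuting
  elements with \<open>0 \<le> z\<^sub>a \<le> 1\<close>, and \<open>\<phi>\<close> for a positive functional.
\<close>

locale splitting =
  fixes P :: "'p set" and \<phi> :: "'p \<Rightarrow> real" and mul sub :: "'m::finite \<Rightarrow> 'p \<Rightarrow> 'p"
  assumes mul_closed: "W \<in> P \<Longrightarrow> mul a W \<in> P"
    and sub_closed: "W \<in> P \<Longrightarrow> sub a W \<in> P"
    and phi_nonneg: "W \<in> P \<Longrightarrow> 0 \<le> \<phi> W"
    and phi_split: "W \<in> P \<Longrightarrow> \<phi> (mul a W) + \<phi> (sub a W) = \<phi> W"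
    and mul_commute: "W \<in> P \<Longrightarrow> mul a (mul b W) = mul b (mul a W)"
    and mul_sub: "W \<in> P \<Longrightarrow> mul b (sub a W) = sub a (mul b W)"
begin

text \<open>
  The second moments of \<open>c + \<delta> X\<close>, where \<open>X\<^sub>a\<close> counts the successes in \<open>count A a\<close> independent
  trials of success probability \<open>z\<^sub>a\<close>.
\<close>

definition bernstein_moment :: "real \<Rightarrow> 'm multiset \<Rightarrow> real^'m \<Rightarrow> 'p \<Rightarrow> real^'m^'m" where
  "bernstein_moment \<delta> A c W = (\<chi> i j.
     c $ i * c $ j * \<phi> W + c $ i * (\<delta> * count A j) * \<phi> (mul j W) + \<delta> * count A i * c $ j * \<phi> (mul i W)
     + \<delta> * count A i * (\<delta> * count A j) * \<phi> (mul i (mul j W))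
     + (if i = j then \<delta>\<^sup>2 * count A i * (\<phi> (mul i W) - \<phi> (mul i (mul i W))) else 0))"

text \<open>Conditioning on one trial of a: success has weight z_a W and moves c by \<delta> in
  direction a, failure has weight (1 - z_a) W and leaves c in place.\<close>

lemma bernstein_moment_split:
  assumes "W \<in> P"
  shows "bernstein_moment \<delta> (add_mset a A) c W =
    bernstein_moment \<delta> A (c + \<delta> *\<^sub>R axis a 1) (mul a W) + bernstein_moment \<delta> A c (sub a W)"
proof -
  \<comment> \<open>Additivity of \<phi> along the split rewrites the moments of
    \<open>sub a W\<close> of order 0, 1 and 2 as differences of moments under
    \<open>mul\<close>.\<close>
  have 0: "\<phi> (sub a W) = \<phi> W - \<phi> (mul a W)"
    using phi_split[OF assms, of a] by simp
  have 1: "\<phi> (mul i (sub a W)) = \<phi> (mul i W) - \<phi> (mul i (mul a W))" for i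
    using phi_split[OF mul_closed[OF assms], of a i] by (simp add: mul_sub mul_commute assms)
  have 2: "\<phi> (mul i (mul j (sub a W))) = \<phi> (mul i (mul j W)) - \<phi> (mul i (mul j (mul a W)))" for i j
    using phi_split[OF mul_closed[OF mul_closed[OF assms]], of a i j]
    by (simp add: mul_sub mul_commute mul_closed assms)
  show ?thesis
    unfolding bernstein_moment_def vec_eq_iff
    by (auto simp: 0 1 2 axis_def mul_commute assms algebra_simps power2_eq_square)
qed

text \<open>Induction on the remaining trials, with the position c and the weight W arbitrary.
  Without trials there is a point mass at c. The bound on c + \<delta> \<open>count A\<close> keeps
  every position that can be reached inside the unit cube.\<close>

lemma bernstein_moment_in_hull:
  fixes \<delta> :: real
  assumes "W \<in> P" "0 \<le> \<delta>" "\<And>i. 0 \<le> c $ i" "\<And>i. c $ i + \<delta> * count A i \<le> 1"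
  shows "bernstein_moment \<delta> A c W \<in> (*\<^sub>R) (\<phi> W) ` (convex hull (outer ` cbox 0 1))"
  using assms
proof (induction A arbitrary: c W)
  case empty
  have "bernstein_moment \<delta> {#} c W = \<phi> W *\<^sub>R outer c"
    by (simp add: bernstein_moment_def outer_def vec_eq_iff)
  moreover have "outer c \<in> convex hull (outer ` cbox 0 1)"
    using empty by (intro hull_inc imageI) (auto simp: mem_box_cart)
  ultimately show ?case by blast
next
  case (add a A)
  \<comment> \<open>The bound includes the trial of a that is split off: on success this trial has
    moved into c, on failure it is dropped.\<close>
  have le: "c $ i + \<delta> * (count A i + (if i = a then 1 else 0)) \<le> 1" for i
    using add.prems(4)[of i] by (auto split: if_splits simp: algebra_simps)
  have "bernstein_moment \<delta> A (c + \<delta> *\<^sub>R axis a 1) (mul a W) + bernstein_moment \<delta> A c (sub a W)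
      \<in> (*\<^sub>R) (\<phi> (mul a W) + \<phi> (sub a W)) ` (convex hull (outer ` cbox 0 1))"
  proof (rule convex_scaled_add)
    show "bernstein_moment \<delta> A (c + \<delta> *\<^sub>R axis a 1) (mul a W)
        \<in> (*\<^sub>R) (\<phi> (mul a W)) ` (convex hull (outer ` cbox 0 1))"
    proof (rule add.IH)
      show "(c + \<delta> *\<^sub>R axis a 1) $ i + \<delta> * count A i \<le> 1" for i
        using le[of i] by (auto simp: axis_def algebra_simps split: if_splits)
    qed (use add.prems in \<open>auto simp: mul_closed axis_def\<close>)
    show "bernstein_moment \<delta> A c (sub a W)
        \<in> (*\<^sub>R) (\<phi> (sub a W)) ` (convex hull (outer ` cbox 0 1))"
    proof (rule add.IH)
      show "c $ i + \<delta> * count A i \<le> 1" for i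
        using le[of i] add.prems(2) by (auto simp: algebra_simps split: if_splits)
    qed (use add.prems in \<open>auto simp: sub_closed\<close>)
  qed (use add.prems in \<open>auto intro!: phi_nonneg mul_closed sub_closed\<close>)
  then show ?case
    using add.prems(1) by (simp add: bernstein_moment_split phi_split)
qed

text \<open>With N + 1 trials for each index and step 1/(N + 1), the second moments differ from the
  wanted matrix only by the binomial variances on the diagonal, which are of order 1/(N + 1). The
  hull is compact, so the limit stays in the scaled hull.\<close>

lemma moment_matrix_in_hull:
  assumes "W \<in> P"
  shows "(\<chi> i j. \<phi> (mul i (mul j W))) \<in> (*\<^sub>R) (\<phi> W) ` (convex hull (outer ` cbox 0 1))"
    (is "?M \<in> ?K")
proof -
  \<comment> \<open>Step times number of trials is exactly 1, so starting at c = 0 the frequencies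
    fill [0,1]; \<open>Suc\<close> keeps the step well defined at N = 0.\<close>
  let ?A = "\<lambda>N. repeat_mset (Suc N) (mset_set (UNIV :: 'm set))"
  let ?B = "\<lambda>N. bernstein_moment (inverse (real (Suc N))) (?A N) 0 W"
  have "?B N = (\<chi> i j. \<phi> (mul i (mul j W)) + inverse (real (Suc N)) *
      (if i = j then \<phi> (mul i W) - \<phi> (mul i (mul i W)) else 0))" for N
    by (simp add: bernstein_moment_def vec_eq_iff power2_eq_square field_simps del: of_nat_Suc)
  moreover have "(\<lambda>N. (\<chi> i j. \<phi> (mul i (mul j W)) + inverse (real (Suc N)) *
      (if i = j then \<phi> (mul i W) - \<phi> (mul i (mul i W)) else 0)) :: real^'m^'m) \<longlonglongrightarrow>
      (\<chi> i j. \<phi> (mul i (mul j W)) + 0 * (if i = j then \<phi> (mul i W) - \<phi> (mul i (mul i W)) else 0))"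
    by (intro tendsto_vec_lambda tendsto_intros LIMSEQ_inverse_real_of_nat)
  ultimately have lim: "?B \<longlonglongrightarrow> ?M" by simp
  have "continuous_on (cbox 0 1) (outer :: real^'m \<Rightarrow> _)"
    unfolding outer_def by (intro continuous_intros)
  then have "compact ?K"
    by (intro compact_scaling compact_convex_hull compact_continuous_image compact_cbox)
  then have "closed ?K" by (rule compact_imp_closed)
  moreover have "?B N \<in> ?K" for N
    using bernstein_moment_in_hull[OF assms, of "inverse (real (Suc N))" 0 "?A N"]
    by (simp del: of_nat_Suc)
  ultimately show ?thesis
    using closed_sequentially[OF _ _ lim] by blast
qed

end

text \<open>A combination of q q^T with weights u is the Gram matrix of vectors with one coordinate
  sqrt (t u) q_i for each q. They are nonnegative because each q lies in the unit cube.\<close>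

lemma hull_outer_cp:
  fixes Y :: "real^'m^'m"
  assumes "Y \<in> convex hull (outer ` cbox 0 1)" "0 \<le> t"
  shows "cp_matrix (\<chi> i j. complex_of_real (t * Y $ i $ j))"
proof -
  obtain S u where S: "finite S" "S \<subseteq> outer ` cbox 0 1" "\<And>x. x \<in> S \<Longrightarrow> 0 \<le> u x" "sum u S = 1"
    and Y: "(\<Sum>v\<in>S. u v *\<^sub>R v) = Y"
    using assms(1) unfolding convex_hull_explicit by blast
  have "\<forall>v\<in>S. \<exists>q. q \<in> cbox 0 1 \<and> v = outer q" using S(2) by auto
  then obtain q where q: "\<And>v. v \<in> S \<Longrightarrow> q v \<in> cbox 0 1 \<and> v = outer (q v)" by metis
  obtain h where h: "bij_betw h {..<card S} S"
    using ex_bij_betw_nat_finite[OF S(1)] by (auto simp: lessThan_atLeast0)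
  let ?p = "\<lambda>i a. sqrt (t * u (h a)) * q (h a) $ i"
  have hS: "h a \<in> S" if "a < card S" for a using h that by (auto simp: bij_betw_def)
  have "t * Y $ i $ j = (\<Sum>a<card S. ?p i a * ?p j a)" for i j
  proof -
    have "t * Y $ i $ j = (\<Sum>v\<in>S. t * u v * (v $ i $ j))"
      by (simp add: Y[symmetric] sum_distrib_left mult.assoc)
    also have "\<dots> = (\<Sum>a<card S. t * u (h a) * (h a $ i $ j))"
      by (rule sum.reindex_bij_betw[OF h, symmetric])
    also have "\<dots> = (\<Sum>a<card S. ?p i a * ?p j a)"
    proof (rule sum.cong[OF refl])
      fix a assume "a \<in> {..<card S}"
      then have a: "h a \<in> S" using hS by simp
      have "h a $ i $ j = q (h a) $ i * q (h a) $ j"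
        using q[OF a] by (metis (no_types) outer_def vec_lambda_beta)
      moreover have "sqrt (t * u (h a)) * sqrt (t * u (h a)) = t * u (h a)"
        using assms(2) S(3)[OF a] by simp
      ultimately show "t * u (h a) * (h a $ i $ j) = ?p i a * ?p j a"
        by (metis (no_types, opaque_lifting) mult.assoc mult.left_commute)
    qed
    finally show ?thesis .
  qed
  moreover have "\<forall>i. \<forall>a<card S. ?p i a \<ge> 0"
    using hS q S(3) assms(2) by (auto simp: mem_box_cart)
  \<comment> \<open>Weights of sum 1 cannot live on the empty set; \<open>cp_matrix\<close> asks for
    at least one coordinate.\<close>
  moreover have "card S \<ge> 1"
    using S(1,4) by (cases "S = {}") (auto simp: Suc_le_eq card_gt_0_iff)
  moreover have "t * Y $ i $ j = t * Y $ j $ i" for i j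
    using calculation(1)[of i j] calculation(1)[of j i] by (simp add: mult.commute)
  ultimately show ?thesis
    unfolding cp_matrix_def vec_eq_iff
    by (intro conjI exI[of _ "card S"] exI[of _ ?p])
      (simp_all only: transpose_def vec_lambda_beta, blast+)
qed

section \<open>Diagonal operators on square-summable families\<close>

lemma ell2_eqI: "(\<And>i. ell2_coord x i = ell2_coord y i) \<Longrightarrow> x = y"
  by (simp add: ell2_coord_inject[symmetric] ext)

lemma cinner_ell2: "cinner x y = (\<Sum>\<^sub>\<infinity>i. ell2_coord x i * cnj (ell2_coord y i))"
  by (simp add: cinner_ell2_def ell2_cinner.rep_eq)

lemma ell2_summable: "(\<lambda>i. (cmod (ell2_coord x i))\<^sup>2) summable_on UNIV"
  using ell2_coord[of x] by simp

definition ell2_basis :: "'i \<Rightarrow> 'i ell2" where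
  "ell2_basis i = Abs_ell2 (\<lambda>j. if j = i then 1 else 0)"

lemma ell2_coord_basis [simp]: "ell2_coord (ell2_basis i) j = (if j = i then 1 else 0)"
proof -
  have "(\<lambda>j. (cmod (if j = i then 1 else 0))\<^sup>2) summable_on {i}" by simp
  then have "(\<lambda>j. (cmod (if j = i then 1 else 0))\<^sup>2) summable_on UNIV"
    by (rule summable_on_cong_neutral[THEN iffD1, rotated -1]) auto
  then show ?thesis by (simp add: ell2_basis_def Abs_ell2_inverse)
qed

lemma cinner_ell2_basis [simp]: "cinner x (ell2_basis i) = ell2_coord x i"
proof -
  have "cinner x (ell2_basis i) = (\<Sum>\<^sub>\<infinity>j\<in>{i}. ell2_coord x j * cnj (ell2_coord (ell2_basis i) j))"
    unfolding cinner_ell2 by (rule infsum_cong_neutral) auto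
  then show ?thesis by simp
qed

lemma norm_ell2_basis [simp]: "norm (ell2_basis i) = 1"
proof -
  have "complex_of_real ((norm (ell2_basis i))\<^sup>2) = 1"
    by (subst cinner_self[symmetric]) simp
  then show ?thesis by (simp add: power2_eq_1_iff del: of_real_power) (use norm_ge_zero[of "ell2_basis i"] in linarith)
qed

text \<open>For unbounded f the product may fail to be square-summable and \<open>Abs_ell2\<close>
  says nothing about it. The facts about \<open>diag_op\<close> therefore assume f to be
  bounded.\<close>

definition diag_op :: "('i \<Rightarrow> complex) \<Rightarrow> 'i ell2 \<Rightarrow> 'i ell2" where
  "diag_op f x = Abs_ell2 (\<lambda>i. f i * ell2_coord x i)"

lemma diag_op_square_summable:
  assumes "\<And>i. cmod (f i) \<le> K"
  shows "(\<lambda>i. (cmod (f i * ell2_coord x i))\<^sup>2) summable_on UNIV"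
proof (rule real_summable_on_comparison)
  show "(\<lambda>i. (cmod (complex_of_real K * ell2_coord x i))\<^sup>2) summable_on UNIV"
    by (rule square_summable_scale) (rule ell2_summable)
  show "(cmod (f i * ell2_coord x i))\<^sup>2 \<le> (cmod (complex_of_real K * ell2_coord x i))\<^sup>2" for i
    using order_trans[OF norm_ge_zero assms[of i]] assms[of i]
    by (auto simp: norm_mult intro!: power_mono mult_right_mono)
qed simp

lemma ell2_coord_diag_op [simp]:
  assumes "bounded (range f)"
  shows "ell2_coord (diag_op f x) i = f i * ell2_coord x i"
proof -
  obtain K where "\<And>i. cmod (f i) \<le> K"
    using assms by (auto simp: bounded_iff)
  then have "(\<lambda>i. (cmod (f i * ell2_coord x i))\<^sup>2) summable_on UNIV"
    by (rule diag_op_square_summable)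
  then show ?thesis by (simp add: diag_op_def Abs_ell2_inverse)
qed

lemma bounded_range_mult:
  fixes f g :: "'i \<Rightarrow> complex"
  assumes "bounded (range f)" "bounded (range g)"
  shows "bounded (range (\<lambda>i. f i * g i))"
proof -
  obtain K L where "\<And>i. cmod (f i) \<le> K" "\<And>i. cmod (g i) \<le> L"
    using assms by (auto simp: bounded_iff)
  then have "cmod (f i * g i) \<le> K * L" for i
    unfolding norm_mult using order_trans[OF norm_ge_zero] by (intro mult_mono) blast+
  then show ?thesis by (auto simp: bounded_iff)
qed

lemma bounded_range_cnj: "bounded (range f) \<Longrightarrow> bounded (range (\<lambda>i. cnj (f i)))"
  by (auto simp: bounded_iff)

lemma bounded_range_indicator: "bounded (range (\<lambda>j. if j = i then 1 else 0 :: complex))"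
  by (auto simp: bounded_iff intro!: exI[of _ 1])

lemma bounded_range_diff:
  fixes f g :: "'i \<Rightarrow> complex"
  assumes "bounded (range f)" "bounded (range g)"
  shows "bounded (range (\<lambda>i. f i - g i))"
proof -
  obtain K L where "\<And>i. cmod (f i) \<le> K" "\<And>i. cmod (g i) \<le> L"
    using assms by (auto simp: bounded_iff)
  then have "cmod (f i - g i) \<le> K + L" for i
    by (meson add_mono norm_triangle_ineq4 order_trans)
  then show ?thesis by (auto simp: bounded_iff)
qed

lemma bounded_clinear_diag_op:
  assumes f: "bounded (range f)"
  shows "bounded_clinear (diag_op f)"
proof -
  obtain K where K: "\<And>i. cmod (f i) \<le> K"
    using f by (auto simp: bounded_iff)
  have "bounded_linear (diag_op f)"
  proof (rule bounded_linear_intro[where K = K])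
    fix x :: "'a ell2"
    have K0: "0 \<le> K" using order_trans[OF norm_ge_zero K] .
    have "(norm (diag_op f x))\<^sup>2 \<le> (\<Sum>\<^sub>\<infinity>i. K\<^sup>2 * (cmod (ell2_coord x i))\<^sup>2)"
      unfolding ell2_norm_sq
    proof (rule infsum_mono)
      show "(\<lambda>i. (cmod (ell2_coord (diag_op f x) i))\<^sup>2) summable_on UNIV" by (rule ell2_summable)
      show "(\<lambda>i. K\<^sup>2 * (cmod (ell2_coord x i))\<^sup>2) summable_on UNIV"
        by (intro summable_on_cmult_right ell2_summable)
      show "(cmod (ell2_coord (diag_op f x) i))\<^sup>2 \<le> K\<^sup>2 * (cmod (ell2_coord x i))\<^sup>2" for i
        using K[of i] f by (auto simp: norm_mult power_mult_distrib intro!: mult_right_mono power_mono)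
    qed
    also have "\<dots> = (norm x * K)\<^sup>2"
      by (simp add: infsum_cmult_right' ell2_norm_sq power_mult_distrib mult.commute)
    finally show "norm (diag_op f x) \<le> norm x * K"
      by (rule power2_le_imp_le) (use K0 in simp)
  qed (auto intro!: ell2_eqI simp: f plus_ell2.rep_eq scaleR_ell2.rep_eq algebra_simps)
  then show ?thesis
    by (auto simp: bounded_clinear_def f scaleC_ell2.rep_eq intro!: ell2_eqI)
qed

definition diagonal_algebra :: "('i ell2 \<Rightarrow> 'i ell2) set" where
  "diagonal_algebra = {diag_op f | f. bounded (range f)}"

lemma diag_op_in [intro]: "bounded (range f) \<Longrightarrow> diag_op f \<in> diagonal_algebra"
  by (auto simp: diagonal_algebra_def)

lemma diag_op_compose:
  "bounded (range f) \<Longrightarrow> bounded (range g) \<Longrightarrow> diag_op f (diag_op g x) = diag_op (\<lambda>i. f i * g i) x"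
  by (intro ell2_eqI) (simp add: bounded_range_mult)

lemma diag_op_diff:
  "bounded (range f) \<Longrightarrow> bounded (range g) \<Longrightarrow> diag_op f x - diag_op g x = diag_op (\<lambda>i. f i - g i) x"
  by (intro ell2_eqI) (simp add: bounded_range_diff minus_ell2.rep_eq algebra_simps)

lemma abelian_diagonal_algebra: "abelian_algebra diagonal_algebra"
  by (auto simp: abelian_algebra_def diagonal_algebra_def fun_eq_iff diag_op_compose mult.commute)

lemma hadj_diag_op:
  assumes "bounded (range f)"
  shows "hadj (diag_op f) = diag_op (\<lambda>i. cnj (f i))"
  by (rule hadj_eqI) (simp add: cinner_ell2 assms bounded_range_cnj mult_ac)

text \<open>The diagonal operators are maximal abelian: commuting with the projections onto the
  basis vectors forces an operator to be diagonal, and its boundedness bounds the entries. Taking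
  the commutant twice then gives the algebra back.\<close>

lemma commutant_diagonal_algebra:
  "commutant diagonal_algebra = (diagonal_algebra :: ('i ell2 \<Rightarrow> 'i ell2) set)"
proof (intro equalityI subsetI)
  fix T :: "'i ell2 \<Rightarrow> 'i ell2" assume "T \<in> diagonal_algebra"
  then show "T \<in> commutant diagonal_algebra"
    using abelian_diagonal_algebra unfolding commutant_def abelian_algebra_def
    by (auto simp: diagonal_algebra_def bounded_clinear_diag_op)
next
  fix T :: "'i ell2 \<Rightarrow> 'i ell2" assume "T \<in> commutant diagonal_algebra"
  then have T: "bounded_clinear T" and comm: "\<And>S. S \<in> diagonal_algebra \<Longrightarrow> T \<circ> S = S \<circ> T"
    by (auto simp: commutant_def)
  define f where "f i = ell2_coord (T (ell2_basis i)) i" for i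
  obtain K where K: "\<And>x. norm (T x) \<le> norm x * K"
    using bounded_linear.bounded[OF bounded_clinearD(5)[OF T]] by blast
  have "cmod (f i) \<le> K" for i
    using order_trans[OF ell2_coord_le_norm K[of "ell2_basis i"]] by (simp add: f_def)
  then have f: "bounded (range f)" by (auto simp: bounded_iff)
  have "T x = diag_op f x" for x
  proof (rule ell2_eqI)
    fix i
    \<comment> \<open>The projection onto the line of the basis vector i, itself diagonal.\<close>
    let ?P = "diag_op (\<lambda>j :: 'i. if j = i then 1 else 0)"
    have P: "?P x = ell2_coord x i *\<^sub>C ell2_basis i"
      by (rule ell2_eqI) (simp add: ell2_coord_diag_op[OF bounded_range_indicator] scaleC_ell2.rep_eq)
    have "ell2_coord (T x) i = ell2_coord (?P (T x)) i"
      by (simp add: ell2_coord_diag_op[OF bounded_range_indicator])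
    also have "?P (T x) = T (?P x)"
      using comm[OF diag_op_in[OF bounded_range_indicator[of i]]] by (simp add: fun_eq_iff)
    also have "\<dots> = ell2_coord x i *\<^sub>C T (ell2_basis i)"
      by (simp add: P bounded_clinearD[OF T])
    finally show "ell2_coord (T x) i = ell2_coord (diag_op f x) i"
      using f by (simp add: scaleC_ell2.rep_eq f_def)
  qed
  then show "T \<in> diagonal_algebra" using f by (auto simp: fun_eq_iff diagonal_algebra_def)
qed

text \<open>An abelian algebra is automatically finite, since V commutes with its adjoint.\<close>

lemma finite_von_neumann_diagonal_algebra:
  "finite_von_neumann_algebra (diagonal_algebra :: ('i ell2 \<Rightarrow> 'i ell2) set)"
proof -
  have 1: "bounded_clinear T" "hadj T \<in> diagonal_algebra"
    if "T \<in> diagonal_algebra" for T :: "'i ell2 \<Rightarrow> 'i ell2"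
  proof -
    obtain f where f: "T = diag_op f" "bounded (range f)"
      using \<open>T \<in> diagonal_algebra\<close> by (auto simp: diagonal_algebra_def)
    show "bounded_clinear T" using f by (simp add: bounded_clinear_diag_op)
    show "hadj T \<in> diagonal_algebra"
      using f by (simp add: hadj_diag_op bounded_range_cnj diag_op_in)
  qed
  moreover have "hadj V \<circ> V = V \<circ> hadj V" if "V \<in> diagonal_algebra" for V :: "'i ell2 \<Rightarrow> 'i ell2"
    using abelian_diagonal_algebra 1(2)[OF that] that unfolding abelian_algebra_def by blast
  ultimately show ?thesis
    by (simp add: finite_von_neumann_algebra_def von_neumann_algebra_def commutant_diagonal_algebra)
qed

text \<open>Basis vectors pick out single entries of f; conversely the quadratic form is the series
  of f_i |x_i|^2.\<close>

lemma positive_diag_op_iff: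
  assumes "bounded (range f)"
  shows "positive_op (diag_op f) \<longleftrightarrow> (\<forall>i. f i \<in> \<real>\<^sub>\<ge>\<^sub>0)"
proof
  assume pos: "positive_op (diag_op f)"
  show "\<forall>i. f i \<in> \<real>\<^sub>\<ge>\<^sub>0"
  proof
    fix i
    have "cinner (diag_op f (ell2_basis i)) (ell2_basis i) \<in> \<real>\<^sub>\<ge>\<^sub>0"
      using pos unfolding positive_op_def by blast
    then show "f i \<in> \<real>\<^sub>\<ge>\<^sub>0" using assms by simp
  qed
next
  assume f: "\<forall>i. f i \<in> \<real>\<^sub>\<ge>\<^sub>0"
  have "cinner (diag_op f x) x \<in> \<real>\<^sub>\<ge>\<^sub>0" for x
  proof -
    have "f i * ell2_coord x i * cnj (ell2_coord x i)
        = complex_of_real (Re (f i) * (cmod (ell2_coord x i))\<^sup>2)" for i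
    proof -
      have "f i = complex_of_real (Re (f i))"
        using f by (simp add: complex_nonneg_Reals_iff complex_eq_iff)
      then show ?thesis
        by (metis complex_norm_square mult.assoc of_real_mult of_real_power)
    qed
    moreover have "((\<lambda>i. ell2_coord (diag_op f x) i * cnj (ell2_coord x i)) has_sum
        cinner (diag_op f x) x) UNIV"
      unfolding cinner_ell2 by (intro has_sum_infsum square_summable_mult ell2_summable)
    ultimately have hs: "((\<lambda>i. complex_of_real (Re (f i) * (cmod (ell2_coord x i))\<^sup>2)) has_sum
        cinner (diag_op f x) x) UNIV"
      using assms by simp
    have "0 \<le> Re (cinner (diag_op f x) x)"
      by (rule has_sum_nonneg[OF has_sum_Re[OF hs]]) (use f in \<open>auto simp: complex_nonneg_Reals_iff\<close>)
    moreover have "Im (cinner (diag_op f x) x) = 0"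
      using infsumI[OF has_sum_Im[OF hs]] by simp
    ultimately show ?thesis by (simp add: complex_nonneg_Reals_iff)
  qed
  then show "positive_op (diag_op f)"
    by (simp add: positive_op_def bounded_clinear_diag_op assms)
qed

lemma op_le_diag_op_iff:
  assumes "bounded (range f)" "bounded (range g)"
  shows "op_le (diag_op f) (diag_op g) \<longleftrightarrow> (\<forall>i. g i - f i \<in> \<real>\<^sub>\<ge>\<^sub>0)"
  by (simp add: op_le_def diag_op_diff positive_diag_op_iff bounded_range_diff assms)

section \<open>A faithful normal trace on the diagonal operators\<close>

text \<open>No coordinate vanishes, which makes the vector functional \<open>weight_trace\<close>
  faithful on the diagonal algebra. The squared coordinates are its weights (1/4)^i.\<close>

definition weight_vector :: "nat ell2" where
  "weight_vector = Abs_ell2 (\<lambda>i. (1/2) ^ i)"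

lemma ell2_coord_weight_vector [simp]: "ell2_coord weight_vector i = (1/2) ^ i"
proof -
  have "(\<lambda>i. (cmod ((1/2) ^ i))\<^sup>2) = (\<lambda>i. (1/4 :: real) ^ i)"
    by (simp add: fun_eq_iff norm_power norm_divide power2_eq_square flip: power_mult_distrib)
  moreover have "(\<lambda>i. (1/4 :: real) ^ i) summable_on UNIV"
    by (rule norm_summable_imp_summable_on) simp
  ultimately show ?thesis by (simp add: weight_vector_def Abs_ell2_inverse)
qed

definition weight_trace :: "(nat ell2 \<Rightarrow> nat ell2) \<Rightarrow> complex" where
  "weight_trace T = cinner (T weight_vector) weight_vector"

lemma weight_trace_diag_op:
  assumes "bounded (range f)"
  shows "weight_trace (diag_op f) = (\<Sum>\<^sub>\<infinity>i. f i * (1/4) ^ i)"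
proof -
  have "(1/2 :: complex) ^ i * (1/2) ^ i = (1/4) ^ i" for i
    by (simp flip: power_mult_distrib)
  then show ?thesis
    by (simp add: weight_trace_def cinner_ell2 assms mult.assoc)
qed

lemma weight_trace_summable:
  assumes "bounded (range f)"
  shows "(\<lambda>i. f i * (1/4 :: complex) ^ i) summable_on UNIV"
proof -
  have "(\<lambda>i. ell2_coord (diag_op f weight_vector) i * cnj (ell2_coord weight_vector i)) summable_on UNIV"
    by (intro square_summable_mult ell2_summable)
  moreover have "(1/2 :: complex) ^ i * (1/2) ^ i = (1/4) ^ i" for i
    by (simp flip: power_mult_distrib)
  ultimately show ?thesis by (simp add: assms mult.assoc)
qed

lemma Re_weight_trace:
  assumes "bounded (range f)"
  shows "((\<lambda>i. Re (f i) * (1/4) ^ i) has_sum Re (weight_trace (diag_op f))) UNIV"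
proof -
  have "Re (f i * (1/4) ^ i) = Re (f i) * (1/4) ^ i" for i
  proof -
    have *: "(1/4 :: complex) ^ i = complex_of_real ((1/4) ^ i)" by simp
    show ?thesis unfolding * by simp
  qed
  then show ?thesis
    using has_sum_Re[OF has_sum_infsum[OF weight_trace_summable[OF assms]]]
    by (simp add: weight_trace_diag_op assms)
qed

lemma finite_trace_weight_trace: "finite_trace diagonal_algebra weight_trace"
proof -
  have "S \<circ> T = T \<circ> S" if "S \<in> diagonal_algebra" "T \<in> diagonal_algebra" for S T :: "nat ell2 \<Rightarrow> _"
    using abelian_diagonal_algebra that by (auto simp: abelian_algebra_def)
  then have "weight_trace (S \<circ> T) = weight_trace (T \<circ> S)"
    if "S \<in> diagonal_algebra" "T \<in> diagonal_algebra" for S T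
    using that by metis
  then show ?thesis
    by (auto simp: finite_trace_def weight_trace_def cinner_add_left cinner_scaleC_left
        positive_op_def)
qed

lemma faithful_weight_trace: "faithful_on diagonal_algebra weight_trace"
  unfolding faithful_on_def
proof (intro ballI impI, elim conjE)
  fix T assume "T \<in> diagonal_algebra" and pos: "positive_op T" and 0: "weight_trace T = 0"
  then obtain f where T: "T = diag_op f" and f: "bounded (range f)"
    by (auto simp: diagonal_algebra_def)
  have nonneg: "f i \<in> \<real>\<^sub>\<ge>\<^sub>0" for i using pos f by (simp add: T positive_diag_op_iff)
  have hs: "((\<lambda>i. Re (f i) * (1/4) ^ i) has_sum 0) UNIV"
    using Re_weight_trace[OF f] 0 by (simp add: T)
  have "Re (f i) * (1/4) ^ i = 0" for i
    by (rule nonneg_infsum_le_0D[where A = UNIV])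
      (use hs nonneg in \<open>auto simp: infsumI has_sum_imp_summable complex_nonneg_Reals_iff\<close>)
  then have "f i = 0" for i using nonneg by (simp add: complex_nonneg_Reals_iff complex_eq_iff)
  then show "T = (\<lambda>x. 0)"
    using f by (auto simp: T zero_ell2.rep_eq intro!: ell2_eqI)
qed

text \<open>The supremum of a directed family of diagonal operators is taken entrywise. Finitely
  many of its entries are approximated by a single member of the family, and the trace is the
  supremum of its finite partial sums.\<close>

lemma normal_weight_trace: "normal_on diagonal_algebra weight_trace"
  unfolding normal_on_def
proof (intro allI impI, elim conjE)
  fix D and S :: "nat ell2 \<Rightarrow> nat ell2"
  assume ne: "D \<noteq> {}" and D: "D \<subseteq> {T \<in> diagonal_algebra. positive_op T}"
    and dir: "\<forall>T\<in>D. \<forall>U\<in>D. \<exists>V\<in>D. op_le T V \<and> op_le U V"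
    and S: "S \<in> diagonal_algebra" and ub: "\<forall>T\<in>D. op_le T S"
    and lub: "\<forall>U\<in>diagonal_algebra. (\<forall>T\<in>D. op_le T U) \<longrightarrow> op_le S U"
  define c :: "(nat ell2 \<Rightarrow> nat ell2) \<Rightarrow> nat \<Rightarrow> complex"
    where "c T i = ell2_coord (T (ell2_basis i)) i" for T i
  have diag: "T = diag_op (c T) \<and> bounded (range (c T))" if T: "T \<in> diagonal_algebra" for T :: "nat ell2 \<Rightarrow> nat ell2"
  proof -
    obtain f where "T = diag_op f" "bounded (range f)"
      using T by (auto simp: diagonal_algebra_def)
    moreover from this have "c T = f" by (auto simp: c_def)
    ultimately show ?thesis by simp
  qed
  have DA: "T \<in> diagonal_algebra" if "T \<in> D" for T using D that by auto
  have le_iff: "op_le T U \<longleftrightarrow> (\<forall>i. c U i - c T i \<in> \<real>\<^sub>\<ge>\<^sub>0)"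
    if "T \<in> diagonal_algebra" "U \<in> diagonal_algebra" for T U
    using op_le_diag_op_iff diag[OF that(1)] diag[OF that(2)] by metis
  have leD: "Re (c T i) \<le> Re (c U i)"
    if "T \<in> diagonal_algebra" "U \<in> diagonal_algebra" "op_le T U" for T U i
    using that le_iff by (auto simp: complex_nonneg_Reals_iff)
  have pos: "c T i \<in> \<real>\<^sub>\<ge>\<^sub>0" if "T \<in> D" for T i
  proof -
    have "positive_op (diag_op (c T))" using that D diag[OF DA[OF that]] by auto
    then show ?thesis using diag[OF DA[OF that]] positive_diag_op_iff by blast
  qed
  have tr: "((\<lambda>i. Re (c T i) * (1/4) ^ i) has_sum Re (weight_trace T)) UNIV"
    if "T \<in> diagonal_algebra" for T
    using Re_weight_trace[of "c T"] diag[OF that] by metis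
  define s where "s i = (SUP T\<in>D. Re (c T i))" for i
  have bdd: "bdd_above ((\<lambda>T. Re (c T i)) ` D)" for i
    using leD[OF DA S] ub by (auto intro!: bdd_aboveI[of _ "Re (c S i)"])
  have s_upper: "Re (c T i) \<le> s i" if "T \<in> D" for T i
    unfolding s_def by (rule cSUP_upper[OF that bdd])
  have s_le: "s i \<le> Re (c S i)" for i
    unfolding s_def using leD[OF DA S] ub by (intro cSUP_least ne) auto
  have s_nonneg: "0 \<le> s i" for i
  proof -
    obtain T where "T \<in> D" using ne by auto
    then show ?thesis using s_upper[of T i] pos[of T i] by (auto simp: complex_nonneg_Reals_iff)
  qed
  have s_bounded: "bounded (range (\<lambda>i. complex_of_real (s i)))"
  proof -
    obtain K where "\<And>i. cmod (c S i) \<le> K"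
      using diag[OF S] by (auto simp: bounded_iff)
    then have "cmod (complex_of_real (s i)) \<le> K" for i
      using s_le[of i] s_nonneg[of i] complex_Re_le_cmod[of "c S i"] by (smt (verit) norm_of_real)
    then show ?thesis by (auto simp: bounded_iff)
  qed
  let ?U = "diag_op (\<lambda>i. complex_of_real (s i))"
  have UA: "?U \<in> diagonal_algebra" using s_bounded by blast
  have cU: "c ?U i = s i" for i using s_bounded by (simp add: c_def)
  have "op_le T ?U" if "T \<in> D" for T
    using s_upper[OF that] pos[OF that]
    by (auto simp: le_iff DA[OF that] UA cU complex_nonneg_Reals_iff)
  \<comment> \<open>The entrywise supremum is an upper bound within the algebra, so the least upper
    bound S lies below it; with \<open>s_le\<close> the entries agree.\<close>
  then have "op_le S ?U" using lub UA by blast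
  then have s_eq: "s i = Re (c S i)" for i
    using leD[OF S UA] cU s_le[of i] by (metis Re_complex_of_real order_antisym)
  \<comment> \<open>Directedness enters here: a common upper bound merges the approximation on F
    with the one at the new index.\<close>
  have approx: "\<exists>T\<in>D. \<forall>i\<in>F. s i - e \<le> Re (c T i)" if "finite F" "0 < e" for F e
    using that(1)
  proof (induction F)
    case empty
    then show ?case using ne by auto
  next
    case (insert j F)
    then obtain T where T: "T \<in> D" "\<And>i. i \<in> F \<Longrightarrow> s i - e \<le> Re (c T i)" by blast
    have "s j - e < (SUP T\<in>D. Re (c T j))" using that(2) by (simp add: s_def)
    then obtain T' where T': "T' \<in> D" "s j - e < Re (c T' j)"
      using less_cSUP_iff[OF ne bdd] by blast
    obtain V where V: "V \<in> D" "op_le T V" "op_le T' V" using dir T(1) T'(1) by blast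
    have "s i - e \<le> Re (c V i)" if "i \<in> insert j F" for i
      using that T T' leD[OF DA[OF T(1)] DA[OF V(1)] V(2), of i]
        leD[OF DA[OF T'(1)] DA[OF V(1)] V(3), of i]
      by fastforce
    then show ?case using V(1) by blast
  qed
  have trace_le: "Re (weight_trace T) \<le> Re (weight_trace S)" if "T \<in> D" for T
    using leD[OF DA[OF that] S] ub that
    by (intro has_sum_mono[OF tr[OF DA[OF that]] tr[OF S]]) (auto intro!: mult_right_mono)
  show "Re (weight_trace S) = (SUP T\<in>D. Re (weight_trace T))"
  proof (rule antisym)
    show "(SUP T\<in>D. Re (weight_trace T)) \<le> Re (weight_trace S)"
      by (intro cSUP_least ne trace_le)
    have bddt: "bdd_above ((\<lambda>T. Re (weight_trace T)) ` D)"
      using trace_le by (auto intro!: bdd_aboveI)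
    show "Re (weight_trace S) \<le> (SUP T\<in>D. Re (weight_trace T))"
    proof (rule has_sum_le_finite_sums[OF tr[OF S]])
      fix F :: "nat set" assume F: "finite F"
      let ?w = "\<Sum>i\<in>F. (1/4 :: real) ^ i"
      show "(\<Sum>i\<in>F. Re (c S i) * (1/4) ^ i) \<le> (SUP T\<in>D. Re (weight_trace T))"
      proof (rule field_le_epsilon)
        fix e :: real assume e: "0 < e"
        have w: "0 \<le> ?w" by (simp add: sum_nonneg)
        \<comment> \<open>The added 1 keeps the denominator positive for empty F, and the total
          error e ?w / (?w + 1) stays below e.\<close>
        have e': "0 < e / (?w + 1)" using e w by simp
        obtain T where T: "T \<in> D" "\<And>i. i \<in> F \<Longrightarrow> s i - e / (?w + 1) \<le> Re (c T i)"
          using approx[OF F e'] by blast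
        have "(\<Sum>i\<in>F. Re (c S i) * (1/4) ^ i) \<le> (\<Sum>i\<in>F. (Re (c T i) + e / (?w + 1)) * (1/4) ^ i)"
          using T(2) by (intro sum_mono mult_right_mono) (auto simp: s_eq[symmetric] diff_le_eq)
        also have "\<dots> = (\<Sum>i\<in>F. Re (c T i) * (1/4) ^ i) + e / (?w + 1) * ?w"
          by (simp add: distrib_right sum.distrib sum_distrib_left)
        also have "(\<Sum>i\<in>F. Re (c T i) * (1/4) ^ i) \<le> Re (weight_trace T)"
          using pos[OF T(1)]
          by (intro finite_sum_le_has_sum[OF tr[OF DA[OF T(1)]] F])
            (auto simp: complex_nonneg_Reals_iff)
        also have "Re (weight_trace T) \<le> (SUP T\<in>D. Re (weight_trace T))"
          by (rule cSUP_upper[OF T(1) bddt])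
        also have "e / (?w + 1) * ?w \<le> e"
          using e w by (simp add: divide_le_eq mult_left_mono)
        finally show "(\<Sum>i\<in>F. Re (c S i) * (1/4) ^ i) \<le> (SUP T\<in>D. Re (weight_trace T)) + e"
          by simp
      qed
    qed
  qed
qed

section \<open>Gram matrices in an abelian algebra\<close>

text \<open>A von Neumann algebra inherits its algebraic closure properties from being a commutant;
  in the applications B is \<open>commutant A\<close>.\<close>

lemma commutant_compose:
  assumes "S \<in> commutant B" "T \<in> commutant B"
  shows "S \<circ> T \<in> commutant B"
  using assms by (auto simp: commutant_def bounded_clinear_compose o_def fun_eq_iff)

lemma commutant_diff:
  assumes "S \<in> commutant B" "T \<in> commutant B" "\<And>U. U \<in> B \<Longrightarrow> bounded_clinear U"
  shows "(\<lambda>x. S x - T x) \<in> commutant B"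
  using assms by (auto simp: commutant_def bounded_clinear_diff fun_eq_iff bounded_clinearD(2))

lemma commutant_scaleC:
  assumes "T \<in> commutant B" "\<And>U. U \<in> B \<Longrightarrow> bounded_clinear U"
  shows "(\<lambda>x. c *\<^sub>C T x) \<in> commutant B"
  using assms by (auto simp: commutant_def bounded_clinear_scaleC fun_eq_iff bounded_clinearD(4))

lemma id_in_commutant: "(\<lambda>x. x) \<in> commutant B"
  by (auto simp: commutant_def bounded_clinear_id o_def)

lemma commutant_bounded_clinear: "T \<in> commutant B \<Longrightarrow> bounded_clinear T"
  by (simp add: commutant_def)

lemma positive_op_scale:
  assumes "positive_op T" "0 \<le> r"
  shows "positive_op (\<lambda>x. complex_of_real r *\<^sub>C T x)"
  using assms by (auto simp: positive_op_def bounded_clinear_scaleC cinner_scaleC_left)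

text \<open>Expanding 0 \<le> ||T x - x||^2 gives 2 Re <T x, x> \<le> ||T x||^2 + ||x||^2 \<le> 2
  ||x||^2.\<close>

lemma positive_op_contraction:
  assumes "positive_op T" "\<And>x. norm (T x) \<le> norm x"
  shows "positive_op (\<lambda>x. x - T x)"
  unfolding positive_op_def
proof (intro conjI allI)
  show "bounded_clinear (\<lambda>x. x - T x)"
    using assms(1) by (auto simp: positive_op_def intro: bounded_clinear_diff bounded_clinear_id)
  fix x
  have "0 \<le> (norm (T x - x))\<^sup>2" by simp
  moreover have "(norm (T x))\<^sup>2 \<le> (norm x)\<^sup>2" using assms(2) by (simp add: power_mono)
  ultimately have "Re (cinner (T x) x) \<le> (norm x)\<^sup>2" unfolding norm_diff_sq by linarith
  then show "cinner (x - T x) x \<in> \<real>\<^sub>\<ge>\<^sub>0"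
    using positive_opD[OF assms(1), of x]
    by (simp add: complex_nonneg_Reals_iff cinner_diff_left cinner_self del: of_real_power)
qed

text \<open>The positive cone of A with the functional Re \<tau> is a \<open>splitting\<close>,
  because products of commuting positive operators are positive. The moment matrix of the weight W =
  1 has the entries \<tau>(z_a z_b).\<close>

lemma abelian_trace_cp_contraction:
  fixes A :: "('h::complex_hilbert_space \<Rightarrow> 'h) set" and z :: "'m::finite \<Rightarrow> 'h \<Rightarrow> 'h"
  assumes vN: "von_neumann_algebra A" and ab: "abelian_algebra A" and tr: "finite_trace A \<tau>"
    and z: "\<And>a. z a \<in> A" "\<And>a. positive_op (z a)" "\<And>a. positive_op (\<lambda>x. x - z a x)"
  obtains Y :: "real^'m^'m" where "Y \<in> convex hull (outer ` cbox 0 1)" "0 \<le> Re (\<tau> (\<lambda>x. x))"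
    "\<And>a b. \<tau> (z a \<circ> z b) = complex_of_real (Re (\<tau> (\<lambda>x. x)) * Y $ a $ b)"
proof -
  have A: "commutant (commutant A) = A"
    using vN by (simp add: von_neumann_algebra_def)
  have id: "(\<lambda>x. x) \<in> A" using id_in_commutant A by metis
  have comp: "S \<circ> T \<in> A" if "S \<in> A" "T \<in> A" for S T
    using commutant_compose[of S "commutant A" T] that A by simp
  have diff: "(\<lambda>x. S x - T x) \<in> A" if "S \<in> A" "T \<in> A" for S T
    using commutant_diff[of S "commutant A" T] that A commutant_bounded_clinear by blast
  have comm: "S \<circ> T = T \<circ> S" if "S \<in> A" "T \<in> A" for S T
    using ab that by (auto simp: abelian_algebra_def)
  have commx: "S (T x) = T (S x)" if "S \<in> A" "T \<in> A" for S T x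
    using comm[OF that] by (simp add: fun_eq_iff)
  have lin: "bounded_clinear T" if "T \<in> A" for T
    using that commutant_bounded_clinear A by blast
  have tau_diff: "\<tau> (\<lambda>x. S x - T x) = \<tau> S - \<tau> T" if "S \<in> A" "T \<in> A" for S T
  proof -
    have "\<tau> (\<lambda>x. (S x - T x) + T x) = \<tau> (\<lambda>x. S x - T x) + \<tau> T"
      using tr diff[OF that] that(2) by (simp only: finite_trace_def)
    then show ?thesis by simp
  qed
  define P where "P = {T \<in> A. positive_op T}"
  have tau_pos: "\<tau> T \<in> \<real>\<^sub>\<ge>\<^sub>0" if "T \<in> P" for T
    using tr that by (auto simp: finite_trace_def P_def)
  have mul_P: "z a \<circ> W \<in> P" if W: "W \<in> P" for a W
  proof -
    \<comment> \<open>The inner factor has to lie between 0 and 1, which is known of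
      \<open>z a\<close> but not of W; commutativity then swaps the factors.\<close>
    have "positive_op (\<lambda>x. W (z a x))"
      by (rule positive_op_compose_contraction) (use W z in \<open>auto simp: P_def commx\<close>)
    moreover have "(\<lambda>x. W (z a x)) = z a \<circ> W"
      using W z by (auto simp: P_def commx)
    ultimately show ?thesis using W z comp by (auto simp: P_def)
  qed
  interpret splitting P "\<lambda>W. Re (\<tau> W)" "\<lambda>a W. z a \<circ> W" "\<lambda>a W x. W x - z a (W x)"
  proof
    fix W a b assume W: "W \<in> P"
    then have WA: "W \<in> A" by (simp add: P_def)
    show "z a \<circ> W \<in> P" using W by (rule mul_P)
    have "positive_op (\<lambda>x. W (x - z a x))"
    proof (rule positive_op_compose_contraction[of W "\<lambda>x. x - z a x"])
      have "(\<lambda>x. x - (x - z a x)) = z a" by simp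
      then show "positive_op (\<lambda>x. x - (x - z a x))" using z(2) by simp
    qed (use W WA z in \<open>auto simp: P_def bounded_clinearD(2)[OF lin] commx\<close>)
    moreover have "W (x - z a x) = W x - z a (W x)" for x
      using WA z by (simp add: bounded_clinearD(2)[OF lin] commx)
    moreover have "(\<lambda>x. W x - z a (W x)) \<in> A"
      using diff[OF WA comp[OF z(1) WA]] by (simp add: o_def)
    ultimately show "(\<lambda>x. W x - z a (W x)) \<in> P" by (simp add: P_def)
    show "0 \<le> Re (\<tau> W)" using tau_pos[OF W] by (simp add: complex_nonneg_Reals_iff)
    show "Re (\<tau> (z a \<circ> W)) + Re (\<tau> (\<lambda>x. W x - z a (W x))) = Re (\<tau> W)"
      using tau_diff[OF WA comp[OF z(1) WA], of a] by (simp add: o_def)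
    show "z a \<circ> (z b \<circ> W) = z b \<circ> (z a \<circ> W)"
      using commx[OF z(1) z(1)] by (simp add: fun_eq_iff)
    show "z b \<circ> (\<lambda>x. W x - z a (W x)) = (\<lambda>x. (z b \<circ> W) x - z a ((z b \<circ> W) x))"
      using commx[OF z(1) z(1)] by (simp add: fun_eq_iff bounded_clinearD(2)[OF lin[OF z(1)]])
  qed
  have idP: "(\<lambda>x. x) \<in> P" by (simp add: P_def id positive_op_id)
  obtain Y where Y: "Y \<in> convex hull (outer ` cbox 0 1)"
    "(\<chi> i j. Re (\<tau> (z i \<circ> (z j \<circ> (\<lambda>x. x))))) = Re (\<tau> (\<lambda>x. x)) *\<^sub>R Y"
    using moment_matrix_in_hull[OF idP] by blast
  have "\<tau> (z a \<circ> z b) = complex_of_real (Re (\<tau> (\<lambda>x. x)) * Y $ a $ b)" for a b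
  proof -
    have "Re (\<tau> (z a \<circ> z b)) = Re (\<tau> (\<lambda>x. x)) * Y $ a $ b"
      using arg_cong[OF Y(2), of "\<lambda>M. M $ a $ b"] by (simp add: o_def)
    \<comment> \<open>Positivity of the product makes the trace real, so the identity of real parts
      is enough.\<close>
    moreover have "\<tau> (z a \<circ> z b) \<in> \<real>\<^sub>\<ge>\<^sub>0"
      using tau_pos[OF mul_P[of "z b" a]] z by (simp add: P_def)
    ultimately show ?thesis by (simp add: complex_nonneg_Reals_iff complex_eq_iff)
  qed
  then show ?thesis using that Y(1) phi_nonneg[OF idP] by blast
qed

text \<open>Finitely many bounded operators have a common bound s. The contraction case applies to
  w_a = z_a / s, and the factor s^2 is restored by linearity of \<tau>.\<close>

lemma abelian_trace_cp:
  fixes A :: "('h::complex_hilbert_space \<Rightarrow> 'h) set" and z :: "'m::finite \<Rightarrow> 'h \<Rightarrow> 'h"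
  assumes vN: "von_neumann_algebra A" and ab: "abelian_algebra A" and tr: "finite_trace A \<tau>"
    and z: "\<And>a. z a \<in> A" "\<And>a. positive_op (z a)"
  shows "cp_matrix (\<chi> a b. \<tau> (z a \<circ> z b))"
proof -
  have lin: "bounded_clinear (z a)" for a using z by (simp add: positive_op_def)
  have "\<forall>a. \<exists>K. \<forall>x. norm (z a x) \<le> norm x * K"
    using bounded_linear.bounded[OF bounded_clinearD(5)[OF lin]] by blast
  then obtain K where K: "\<And>a x. norm (z a x) \<le> norm x * K a" by metis
  \<comment> \<open>The summand 1 makes s invertible even if all K vanish; absolute values are taken
    because the K come without a sign.\<close>
  define s where "s = 1 + (\<Sum>a\<in>UNIV. \<bar>K a\<bar>)"
  have s: "0 < s" unfolding s_def by (simp add: add_pos_nonneg sum_nonneg)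
  have Ks: "K a \<le> s" for a
  proof -
    have "\<bar>K a\<bar> \<le> (\<Sum>a\<in>UNIV. \<bar>K a\<bar>)" by (rule member_le_sum) auto
    then show ?thesis by (simp add: s_def)
  qed
  define w where "w a = (\<lambda>x. complex_of_real (inverse s) *\<^sub>C z a x)" for a
  have A: "commutant (commutant A) = A"
    using vN by (simp add: von_neumann_algebra_def)
  have wA: "w a \<in> A" for a
    unfolding w_def using commutant_scaleC[of "z a" "commutant A"] z A commutant_bounded_clinear
    by blast
  have wpos: "positive_op (w a)" for a
    unfolding w_def using z s by (intro positive_op_scale) auto
  have "norm (w a x) \<le> norm x" for a x
  proof -
    have "norm (z a x) \<le> norm x * s"
      using K[of a x] mult_left_mono[OF Ks[of a] norm_ge_zero[of x]] by simp
    then have "inverse s * norm (z a x) \<le> norm x" using s by (simp add: field_simps)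
    then show ?thesis using s by (simp only: w_def norm_scaleC norm_of_real abs_of_pos positive_imp_inverse_positive)
  qed
  then have "positive_op (\<lambda>x. x - w a x)" for a
    by (rule positive_op_contraction[OF wpos])
  then obtain Y :: "real^'m^'m" where Y: "Y \<in> convex hull (outer ` cbox 0 1)"
    "0 \<le> Re (\<tau> (\<lambda>x. x))" "\<And>a b. \<tau> (w a \<circ> w b) = complex_of_real (Re (\<tau> (\<lambda>x. x)) * Y $ a $ b)"
    by (rule abelian_trace_cp_contraction[where z = w, OF vN ab tr wA wpos]) blast
  have wwA: "w a \<circ> w b \<in> A" for a b
    using commutant_compose[of "w a" "commutant A" "w b"] wA A by simp
  have "\<tau> (z a \<circ> z b) = complex_of_real (s\<^sup>2 * Re (\<tau> (\<lambda>x. x)) * Y $ a $ b)" for a b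
  proof -
    have "z a \<circ> z b = (\<lambda>x. complex_of_real (s\<^sup>2) *\<^sub>C (w a \<circ> w b) x)"
    proof
      fix x
      let ?r = "complex_of_real (inverse s)"
      have "complex_of_real (s\<^sup>2) * (?r * ?r) = of_real (s\<^sup>2 * (inverse s * inverse s))"
        by (simp only: of_real_mult)
      also have "\<dots> = 1" using s by (simp add: power2_eq_square field_simps)
      finally show "(z a \<circ> z b) x = complex_of_real (s\<^sup>2) *\<^sub>C (w a \<circ> w b) x"
        by (simp only: w_def o_def bounded_clinearD(4)[OF lin] scaleC_scaleC scaleC_one)
    qed
    then have "\<tau> (z a \<circ> z b) = complex_of_real (s\<^sup>2) * \<tau> (w a \<circ> w b)"
      using tr wwA unfolding finite_trace_def by metis
    then show ?thesis by (simp add: Y(3) mult.assoc)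
  qed
  then show ?thesis
    using hull_outer_cp[OF Y(1), of "s\<^sup>2 * Re (\<tau> (\<lambda>x. x))"] Y(2) by simp
qed

section \<open>Choi matrices, factorizations and Kraus operators\<close>

lemma choi_matrix_nth:
  "choi_matrix \<Phi> $ p $ q = \<Phi> (matrix_unit (fst p) (fst q)) $ snd p $ snd q"
proof -
  have "choi_matrix \<Phi> $ p $ q = (\<Sum>i\<in>UNIV. \<Sum>j\<in>UNIV. if i = fst p \<and> j = fst q
      then \<Phi> (matrix_unit i j) $ snd p $ snd q else 0)"
    by (auto simp: choi_matrix_def kronecker_def matrix_unit_def intro!: sum.cong)
  also have "\<dots> = (\<Sum>i\<in>UNIV. if i = fst p then \<Phi> (matrix_unit i (fst q)) $ snd p $ snd q else 0)"
    by (intro sum.cong) auto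
  finally show ?thesis by simp
qed

text \<open>The entries of Z are self-adjoint, so the adjoint of Z is its transpose. Inserting the
  matrix unit with indices k, l leaves the single product Z(i,k) Z(j,l) in entry i, j, and the Choi
  matrix becomes a Gram matrix under \<tau>.\<close>

lemma factorizable_abelian_imp_cp_choi:
  fixes \<Phi> :: "complex^'n^'n \<Rightarrow> complex^'n^'n"
  assumes "positively_factorizable_abelian TYPE('h::complex_hilbert_space) \<Phi>"
  shows "cp_matrix (choi_matrix \<Phi>)"
proof -
  obtain A :: "('h \<Rightarrow> 'h) set" and \<tau> and Z :: "('h \<Rightarrow> 'h)^'n^'n"
    where A: "abelian_algebra A" "von_neumann_algebra A" "finite_trace A \<tau>"
      and Z: "\<And>i j. Z $ i $ j \<in> A" "\<And>i j. positive_op (Z $ i $ j)"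
      and \<Phi>: "\<And>X. \<Phi> X = id_tensor \<tau> (opmat_mult (opmat_mult Z (ampliation X)) (opmat_adj Z))"
    using assms unfolding positively_factorizable_abelian_def positively_factorizable_via_def
      finite_von_neumann_algebra_def by blast
  \<comment> \<open>The vanishing entries of the ampliated matrix unit feed the vector 0 into
    Z.\<close>
  have Z0: "(Z $ i $ j) 0 = 0" for i j
    using Z(2) bounded_clinearD(3) by (auto simp: positive_op_def)
  \<comment> \<open>A Choi index names the matrix unit first: \<open>fst\<close> is a column of Z
    and \<open>snd\<close> a row.\<close>
  let ?z = "\<lambda>p :: 'n \<times> 'n. Z $ snd p $ fst p"
  have "choi_matrix \<Phi> $ p $ q = \<tau> (?z p \<circ> ?z q)" for p q
  proof -
    let ?X = "matrix_unit (fst p) (fst q) :: complex^'n^'n"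
    have "opmat_mult (opmat_mult Z (ampliation ?X)) (opmat_adj Z) $ snd p $ snd q = ?z p \<circ> ?z q"
    proof
      fix x
      have "(opmat_mult (opmat_mult Z (ampliation ?X)) (opmat_adj Z) $ snd p $ snd q) x
          = (\<Sum>k\<in>UNIV. \<Sum>l\<in>UNIV. if k = fst q \<and> l = fst p then (Z $ snd p $ l) ((Z $ snd q $ k) x) else 0)"
        by (auto simp: opmat_mult_def ampliation_def opmat_adj_def hadj_positive[OF Z(2)]
            matrix_unit_def Z0 intro!: sum.cong)
      also have "\<dots> = (\<Sum>k\<in>UNIV. if k = fst q then (Z $ snd p $ fst p) ((Z $ snd q $ k) x) else 0)"
        by (intro sum.cong) auto
      finally show "(opmat_mult (opmat_mult Z (ampliation ?X)) (opmat_adj Z) $ snd p $ snd q) x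
        = (?z p \<circ> ?z q) x" by simp
    qed
    then show ?thesis
      by (simp add: choi_matrix_nth \<Phi> id_tensor_def)
  qed
  then have "choi_matrix \<Phi> = (\<chi> p q. \<tau> (?z p \<circ> ?z q))"
    by (simp add: vec_eq_iff)
  then show ?thesis
    using abelian_trace_cp[OF A(2,1,3), of ?z] Z by simp
qed

lemma matrix_conj_nth:
  "(L ** X ** ctranspose L) $ i $ j = (\<Sum>k\<in>UNIV. \<Sum>l\<in>UNIV. L $ i $ k * X $ k $ l * cnj (L $ j $ l))"
proof -
  have "(L ** X ** ctranspose L) $ i $ j
      = (\<Sum>l\<in>UNIV. \<Sum>k\<in>UNIV. L $ i $ k * X $ k $ l * cnj (L $ j $ l))"
    by (simp add: matrix_matrix_mult_def ctranspose_def sum_distrib_right)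
  then show ?thesis by (subst (asm) sum.swap)
qed

lemma matrix_unit_conj_nth:
  "(L ** matrix_unit k l ** ctranspose L) $ i $ j = L $ i $ k * cnj (L $ j $ l)"
proof -
  have "(L ** matrix_unit k l ** ctranspose L) $ i $ j
      = (\<Sum>k'\<in>UNIV. \<Sum>l'\<in>UNIV. if l' = l then if k' = k then L $ i $ k * cnj (L $ j $ l) else 0 else 0)"
    unfolding matrix_conj_nth by (intro sum.cong) (auto simp: matrix_unit_def)
  then show ?thesis by simp
qed

lemma sum_list_nth_matrix: "(\<Sum>x\<leftarrow>xs. f x) $ i $ j = (\<Sum>x\<leftarrow>xs. f x $ i $ j)"
  by (induction xs) auto

lemma nonneg_kraus_imp_cp_choi:
  assumes kr: "kraus_operators Ls \<Phi>" and nn: "\<forall>L\<in>set Ls. entrywise_nonneg L"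
  shows "cp_matrix (choi_matrix \<Phi>)"
proof -
  \<comment> \<open>One more coordinate, constantly 0, makes the length at least 1 even for an empty
    list of Kraus operators.\<close>
  let ?p = "\<lambda>p a. if a < length Ls then Re (Ls ! a $ snd p $ fst p) else 0"
  have re: "Ls ! a $ i $ j = complex_of_real (Re (Ls ! a $ i $ j))" "0 \<le> Re (Ls ! a $ i $ j)"
    if "a < length Ls" for a i j
    using nn that by (auto simp: entrywise_nonneg_def complex_nonneg_Reals_iff complex_eq_iff)
  have "choi_matrix \<Phi> $ p $ q = complex_of_real (\<Sum>a<Suc (length Ls). ?p p a * ?p q a)" for p q
  proof -
    have "choi_matrix \<Phi> $ p $ q = (\<Sum>L\<leftarrow>Ls. L $ snd p $ fst p * cnj (L $ snd q $ fst q))"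
      using kr by (simp add: choi_matrix_nth kraus_operators_def sum_list_nth_matrix matrix_unit_conj_nth)
    also have "\<dots> = (\<Sum>a<length Ls. Ls ! a $ snd p $ fst p * cnj (Ls ! a $ snd q $ fst q))"
      by (simp add: sum_list_sum_nth atLeast0LessThan)
    also have "\<dots> = (\<Sum>a<length Ls. complex_of_real (?p p a * ?p q a))"
      by (intro sum.cong refl) (use re in \<open>auto, metis complex_cnj_complex_of_real\<close>)
    finally show ?thesis by simp
  qed
  moreover from this have "transpose (choi_matrix \<Phi>) = choi_matrix \<Phi>"
    by (simp add: transpose_def vec_eq_iff mult.commute)
  ultimately show ?thesis
    unfolding cp_matrix_def
    by (intro conjI exI[of _ "Suc (length Ls)"] exI[of _ ?p]) (use re in auto)
qed

lemma matrix_expansion: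
  "X = (\<Sum>k\<in>UNIV. \<Sum>l\<in>UNIV. (\<chi> i j. X $ k $ l * matrix_unit k l $ i $ j))"
proof -
  have "(\<Sum>k\<in>UNIV. \<Sum>l\<in>UNIV. X $ k $ l * matrix_unit k l $ i $ j)
      = (\<Sum>k\<in>UNIV. \<Sum>l\<in>UNIV. if l = j then if k = i then X $ i $ j else 0 else 0)" for i j
    by (intro sum.cong) (auto simp: matrix_unit_def)
  then show ?thesis by (simp add: vec_eq_iff)
qed

lemma clinear_map_nth:
  assumes "clinear_map \<Phi>"
  shows "\<Phi> X $ i $ j = (\<Sum>k\<in>UNIV. \<Sum>l\<in>UNIV. X $ k $ l * \<Phi> (matrix_unit k l) $ i $ j)"
proof -
  have add: "\<Phi> (X + Y) = \<Phi> X + \<Phi> Y" for X Y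
    using assms by (auto simp: clinear_map_def)
  have scale: "\<Phi> (\<chi> i j. c * X $ i $ j) = (\<chi> i j. c * \<Phi> X $ i $ j)" for c X
    using assms by (auto simp: clinear_map_def)
  have zero: "\<Phi> 0 = 0" using add[of 0 0] by simp
  have sum: "\<Phi> (sum f S) = (\<Sum>s\<in>S. \<Phi> (f s))" for f S
    by (induction S rule: infinite_finite_induct) (simp_all add: add zero)
  show ?thesis
    by (subst matrix_expansion[of X]) (simp add: sum scale)
qed

text \<open>Coordinate a of all the vectors p, reshaped into a matrix, is the Kraus operator L a.
  The resulting sum agrees with \<Phi> on matrix units, hence everywhere by linearity.\<close>

lemma cp_choi_imp_nonneg_kraus:
  assumes lin: "clinear_map \<Phi>" and cp: "cp_matrix (choi_matrix \<Phi>)"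
  shows "\<exists>Ls. kraus_operators Ls \<Phi> \<and> (\<forall>L\<in>set Ls. entrywise_nonneg L)"
proof -
  obtain k and p :: "_ \<Rightarrow> nat \<Rightarrow> real" where p: "\<And>i a. a < k \<Longrightarrow> 0 \<le> p i a"
    and J: "\<And>i j. choi_matrix \<Phi> $ i $ j = complex_of_real (\<Sum>a<k. p i a * p j a)"
    using cp unfolding cp_matrix_def by blast
  \<comment> \<open>The swap of i and j is the Choi indexing, column before row.\<close>
  define L :: "nat \<Rightarrow> complex^'a^'a" where "L a = (\<chi> i j. complex_of_real (p (j, i) a))" for a
  have "\<Phi> X $ i $ j = (\<Sum>a<k. (L a ** X ** ctranspose (L a)) $ i $ j)" for X i j
  proof -
    have unit: "\<Phi> (matrix_unit m l) $ i $ j = (\<Sum>a<k. L a $ i $ m * cnj (L a $ j $ l))" for m l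
      using choi_matrix_nth[of \<Phi> "(m, i)" "(l, j)"] J[of "(m, i)" "(l, j)"] by (simp add: L_def)
    have "\<Phi> X $ i $ j = (\<Sum>m\<in>UNIV. \<Sum>l\<in>UNIV. \<Sum>a<k. L a $ i $ m * X $ m $ l * cnj (L a $ j $ l))"
      unfolding clinear_map_nth[OF lin, of X] unit
      by (simp only: sum_distrib_left mult.assoc mult.left_commute)
    also have "\<dots> = (\<Sum>m\<in>UNIV. \<Sum>a<k. \<Sum>l\<in>UNIV. L a $ i $ m * X $ m $ l * cnj (L a $ j $ l))"
      by (intro sum.cong refl sum.swap)
    also have "\<dots> = (\<Sum>a<k. \<Sum>m\<in>UNIV. \<Sum>l\<in>UNIV. L a $ i $ m * X $ m $ l * cnj (L a $ j $ l))"
      by (rule sum.swap)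
    finally show ?thesis by (simp add: matrix_conj_nth)
  qed
  then have "kraus_operators (map L [0..<k]) \<Phi>"
    by (simp add: kraus_operators_def vec_eq_iff sum_list_nth_matrix sum_list_sum_nth
        atLeast0LessThan)
  moreover have "\<forall>M\<in>set (map L [0..<k]). entrywise_nonneg M"
    using p by (auto simp: entrywise_nonneg_def L_def)
  ultimately show ?thesis by blast
qed

section \<open>From nonnegative Kraus operators to a factorization\<close>

lemma bounded_range_eventually_zero:
  fixes h :: "nat \<Rightarrow> complex"
  assumes "\<And>a. n \<le> a \<Longrightarrow> h a = 0"
  shows "bounded (range h)"
proof (rule finite_imp_bounded, rule finite_subset)
  show "range h \<subseteq> insert 0 (h ` {..<n})"
    using assms by (auto simp: image_iff) (metis lessThan_iff not_le)
qed simp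

lemma nonneg_kraus_imp_factorizable_abelian:
  fixes \<Phi> :: "complex^'n^'n \<Rightarrow> complex^'n^'n"
  assumes kr: "kraus_operators Ls \<Phi>" and nn: "\<forall>L\<in>set Ls. entrywise_nonneg L"
  shows "positively_factorizable_abelian TYPE(nat ell2) \<Phi>"
proof -
  \<comment> \<open>The trace weighs the \<open>a\<close>-th entry by \<open>(1/4)\<^sup>a\<close>, and each Kraus operator occurs twice in \<open>Z X Z\<^sup>*\<close>.\<close>
  define f :: "'n \<Rightarrow> 'n \<Rightarrow> nat \<Rightarrow> complex"
    where "f i j a = (if a < length Ls then 2 ^ a * (Ls ! a $ i $ j) else 0)" for i j a
  have f0: "f i j a = 0" if "length Ls \<le> a" for i j a using that by (simp add: f_def)
  have bd: "bounded (range (f i j))" for i j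
    by (rule bounded_range_eventually_zero[OF f0])
  define Z :: "(nat ell2 \<Rightarrow> nat ell2)^'n^'n" where "Z = (\<chi> i j. diag_op (f i j))"
  have re: "Ls ! a $ i $ j \<in> \<real>\<^sub>\<ge>\<^sub>0" if "a < length Ls" for a i j
    using nn that by (auto simp: entrywise_nonneg_def)
  have Zpos: "positive_op (Z $ i $ j)" for i j
  proof -
    have "f i j a \<in> \<real>\<^sub>\<ge>\<^sub>0" for a
    proof (cases "a < length Ls")
      case True
      have "(2 :: complex) ^ a = complex_of_real (2 ^ a)" by simp
      then have "(2 :: complex) ^ a \<in> \<real>\<^sub>\<ge>\<^sub>0" by (metis nonneg_Reals_of_real_iff zero_le_numeral zero_le_power)
      then show ?thesis using re[OF True] True by (simp add: f_def)
    qed (simp add: f_def)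
    then show ?thesis by (simp add: Z_def positive_diag_op_iff[OF bd])
  qed
  have "\<Phi> X = id_tensor weight_trace (opmat_mult (opmat_mult Z (ampliation X)) (opmat_adj Z))" for X
  proof -
    have "\<Phi> X $ i $ j = weight_trace (opmat_mult (opmat_mult Z (ampliation X)) (opmat_adj Z) $ i $ j)"
      for i j
    proof -
      let ?W = "opmat_mult (opmat_mult Z (ampliation X)) (opmat_adj Z) $ i $ j"
      have coord_sum: "ell2_coord (sum g S) a = (\<Sum>s\<in>S. ell2_coord (g s) a)" for g :: "'n \<Rightarrow> nat ell2" and S a
        by (induction S rule: infinite_finite_induct) (simp_all add: zero_ell2.rep_eq plus_ell2.rep_eq)
      let ?g = "\<lambda>a. \<Sum>k\<in>UNIV. \<Sum>l\<in>UNIV. f i l a * X $ l $ k * f j k a"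
      have bg: "bounded (range ?g)"
        by (rule bounded_range_eventually_zero[of "length Ls"]) (simp add: f0)
      have "?W = diag_op ?g"
      proof (intro ext ell2_eqI)
        fix x a
        show "ell2_coord (?W x) a = ell2_coord (diag_op ?g x) a"
          unfolding ell2_coord_diag_op[OF bg]
          by (simp add: opmat_mult_def ampliation_def opmat_adj_def coord_sum
              hadj_positive[OF Zpos[unfolded Z_def vec_lambda_beta]]
              Z_def ell2_coord_diag_op[OF bd] scaleC_ell2.rep_eq sum_distrib_right mult.assoc)
      qed
      then have "weight_trace ?W = (\<Sum>\<^sub>\<infinity>a. ?g a * (1/4) ^ a)"
        by (simp only: weight_trace_diag_op[OF bg])
      also have "\<dots> = (\<Sum>\<^sub>\<infinity>a\<in>{..<length Ls}. ?g a * (1/4) ^ a)"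
        by (rule infsum_cong_neutral) (auto simp: f0)
      also have "\<dots> = (\<Sum>a<length Ls. ?g a * (1/4) ^ a)" by simp
      also have "\<dots> = (\<Sum>a<length Ls. (Ls ! a ** X ** ctranspose (Ls ! a)) $ i $ j)"
      proof (rule sum.cong[OF refl])
        fix a assume a: "a \<in> {..<length Ls}"
        have w: "(2 :: complex) ^ a * (2 ^ a * (1/4) ^ a) = 1"
          by (simp flip: power_mult_distrib)
        \<comment> \<open>Conjugation is invisible on nonnegative entries, which reconciles the
          transpose of Z with \<open>ctranspose\<close> in the Kraus form.\<close>
        have cnj: "cnj (Ls ! a $ j $ k) = Ls ! a $ j $ k" for k
          using re[of a j k] a by (simp add: complex_nonneg_Reals_iff complex_eq_iff)
        have "?g a * (1/4) ^ a = (\<Sum>k\<in>UNIV. \<Sum>l\<in>UNIV. Ls ! a $ i $ l * X $ l $ k * cnj (Ls ! a $ j $ k))"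
          unfolding sum_distrib_right cnj
        proof (intro sum.cong refl)
          fix k l
          have "f i l a * X $ l $ k * f j k a * (1/4) ^ a
              = (Ls ! a $ i $ l * X $ l $ k * Ls ! a $ j $ k) * (2 ^ a * (2 ^ a * (1/4) ^ a))"
            using a by (simp only: f_def lessThan_iff if_True mult_ac)
          then show "f i l a * X $ l $ k * f j k a * (1/4) ^ a = Ls ! a $ i $ l * X $ l $ k * Ls ! a $ j $ k"
            by (simp only: w mult_1_right)
        qed
        also have "\<dots> = (Ls ! a ** X ** ctranspose (Ls ! a)) $ i $ j"
          unfolding matrix_conj_nth by (rule sum.swap)
        finally show "?g a * (1/4) ^ a = (Ls ! a ** X ** ctranspose (Ls ! a)) $ i $ j" .
      qed
      also have "\<dots> = \<Phi> X $ i $ j"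
        using kr by (simp add: kraus_operators_def sum_list_nth_matrix sum_list_sum_nth atLeast0LessThan)
      finally show ?thesis by simp
    qed
    then show ?thesis by (simp add: vec_eq_iff id_tensor_def)
  qed
  moreover have "Z $ i $ j \<in> diagonal_algebra" for i j
    using diag_op_in[OF bd[of i j]] by (simp add: Z_def)
  ultimately have "positively_factorizable_via diagonal_algebra weight_trace \<Phi>"
    unfolding positively_factorizable_via_def
    using finite_von_neumann_diagonal_algebra finite_trace_weight_trace faithful_weight_trace
      normal_weight_trace Zpos by blast
  then show ?thesis
    using abelian_diagonal_algebra unfolding positively_factorizable_abelian_def by blast
qed

theorem theorem3p2:
  fixes \<Phi> :: "complex^'n^'n \<Rightarrow> complex^'n^'n" and Ks :: "(complex^'n^'n) list"
  assumes "quantum_channel \<Phi>"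
    and "kraus_operators Ks \<Phi>"
  shows "(positively_factorizable_abelian TYPE('h::complex_hilbert_space) \<Phi> \<longrightarrow>
            positively_factorizable_abelian TYPE(nat ell2) \<Phi>) \<and>
         (positively_factorizable_abelian TYPE(nat ell2) \<Phi> \<longleftrightarrow>
            (\<exists>Ls. kraus_operators Ls \<Phi> \<and> (\<forall>L\<in>set Ls. entrywise_nonneg L))) \<and>
         ((\<exists>Ls. kraus_operators Ls \<Phi> \<and> (\<forall>L\<in>set Ls. entrywise_nonneg L)) \<longleftrightarrow>
            cp_matrix (choi_matrix \<Phi>))"
proof -
  have lin: "clinear_map \<Phi>"
    using assms(1) by (simp add: quantum_channel_def completely_positive_map_def)
  \<comment> \<open>The implications form a cycle: factorizability, a CP Choi matrix, nonnegative
    Kraus operators, factorizability over \<open>nat ell2\<close>. The first link is instantiated at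
    both Hilbert spaces, which also transfers factorizability from \<open>'h\<close> to
    \<open>nat ell2\<close>.\<close>
  show ?thesis
    using factorizable_abelian_imp_cp_choi[where 'h = 'h and \<Phi> = \<Phi>]
      factorizable_abelian_imp_cp_choi[where 'h = "nat ell2" and \<Phi> = \<Phi>]
      cp_choi_imp_nonneg_kraus[OF lin] nonneg_kraus_imp_cp_choi[of _ \<Phi>]
      nonneg_kraus_imp_factorizable_abelian[of _ \<Phi>]
    by blast
qed

end
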